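(* For any integer $m\geq 1$ there exists a one dimensional curve $s\mapsto(c_s,\varphi_s)$, with $s\in I$, such that $$\varphi_s\in X_m:=\left\{f\in C^{2,\alpha}([0,2\pi]) : f(\xi)=\sum_{k\geq 1}f_k\cos(mk\xi)\right\},\qquad \|f\|_{X_m}=\|f\|_{C^{2,\alpha}},$$ is a (nontrivial) $m$-fold traveling wave solution, with constant speed $c_s\in\mathbb{R}$, of the equation $$g_t+2\mathcal{N}g=-\mathcal{N}(g^2)+2\mathcal{Q}\left(g_{zz}\,\mathcal{N}g-g\,\mathcal{N}g_{zz}\right).$$ That is, for every $s\in I$ the function $g(z,t)=\varphi_s(z-c_st)$ solves this equation.
   Context: Here $0<\alpha<1$ is fixed, and functions in $C^{2,\alpha}([0,2\pi])$ given by cosine series are identified with their $2\pi$-periodic extensions to $\mathbb{R}$, which are of class $C^{2,\alpha}$. For $2\pi$-periodic functions of $z$ (or $\xi$), the operators $\mathcal{Q}$ and $\mathcal{N}$ are the Fourier multipliers $$\widehat{\mathcal{Q}F}(k)=\frac{1}{1+k^2}\hat F(k),\qquad \widehat{\mathcal{N}F}(k)=\widehat{\partial_z\mathcal{Q}F}(k)=\frac{ik}{1+k^2}\hat F(k),\qquad k\in\mathbb{Z},$$ i.e. $\mathcal{Q}=(1-\partial_z^2)^{-1}$ and $\mathcal{N}=\partial_z\mathcal{Q}$; $\mathcal{N}g_{zz}$ means $\mathcal{N}(\partial_z^2g)$. A function $\varphi$ is a traveling wave profile with speed $c$ if and only if $$-c\varphi'+2\mathcal{N}\varphi+\mathcal{N}(\varphi^2)-2\mathcal{Q}\left(\varphi''\,\mathcal{N}\varphi-\varphi\,\mathcal{N}\varphi''\right)=0.$$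 "$m$-fold" means that the profile belongs to $X_m$. "One dimensional curve" means that $I\subset\mathbb{R}$ is a nondegenerate interval and $s\mapsto(c_s,\varphi_s)\in\mathbb{R}\times X_m$ is continuous and injective. "Nontrivial" means that $\varphi_s$ is not identically zero. *)

theory Defs
  imports "HOL-Analysis.Analysis"
begin

definition fourier_coeff :: "(real \<Rightarrow> real) \<Rightarrow> int \<Rightarrow> complex" where
  "fourier_coeff F k =
     integral {0..2 * pi} (\<lambda>x. complex_of_real (F x) * cis (- (of_int k * x))) / (2 * pi)"

text \<open>
  The periodic function with Fourier coefficients \<open>\<mu> k * fourier_coeff F k\<close>, as the sum of its
  Fourier series. For the two symbols below and continuous \<open>F\<close> the series converges absolutely:
  the symbols are square summable, and so are the coefficients of \<open>F\<close>.
\<close>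

definition fourier_multiplier :: "(int \<Rightarrow> complex) \<Rightarrow> (real \<Rightarrow> real) \<Rightarrow> real \<Rightarrow> complex" where
  "fourier_multiplier \<mu> F z = (\<Sum>\<^sub>\<infinity>k. \<mu> k * fourier_coeff F k * cis (of_int k * z))"

text \<open>
  Both symbols satisfy \<open>\<mu> (- k) = cnj (\<mu> k)\<close>, so these operators preserve real-valued functions
  and taking the real part loses nothing; see \<open>of_real_opQ\<close> and \<open>of_real_opN\<close>.
\<close>

definition opQ :: "(real \<Rightarrow> real) \<Rightarrow> real \<Rightarrow> real" where
  "opQ F z = Re (fourier_multiplier (\<lambda>k. 1 / (1 + (of_int k)\<^sup>2)) F z)"

definition opN :: "(real \<Rightarrow> real) \<Rightarrow> real \<Rightarrow> real" where
  "opN F z = Re (fourier_multiplier (\<lambda>k. \<i> * of_int k / (1 + (of_int k)\<^sup>2)) F z)"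

lemma cnj_fourier_coeff: "cnj (fourier_coeff F k) = fourier_coeff F (- k)"
  unfolding fourier_coeff_def by (simp add: integral_cnj cis_cnj)

lemma fourier_multiplier_real:
  assumes "\<And>k. \<mu> (- k) = cnj (\<mu> k)"
  shows "complex_of_real (Re (fourier_multiplier \<mu> F z)) = fourier_multiplier \<mu> F z"
proof -
  let ?t = "\<lambda>k. \<mu> k * fourier_coeff F k * cis (of_int k * z)"
  have "cnj (fourier_multiplier \<mu> F z) = (\<Sum>\<^sub>\<infinity>k. cnj (?t k))"
    unfolding fourier_multiplier_def by (rule infsum_cnj [symmetric])
  also have "\<dots> = (\<Sum>\<^sub>\<infinity>k. ?t (- k))"
    by (simp add: assms cnj_fourier_coeff cis_cnj)
  also have "\<dots> = (\<Sum>\<^sub>\<infinity>k. ?t k)"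
    by (rule infsum_reindex_bij_betw[where g = uminus and f = ?t])
       (auto intro: bij_betwI[where g = uminus])
  finally have "cnj (fourier_multiplier \<mu> F z) = fourier_multiplier \<mu> F z"
    unfolding fourier_multiplier_def .
  then show ?thesis
    by (metis Reals_cnj_iff of_real_Re)
qed

lemma of_real_opQ:
  "complex_of_real (opQ F z) = fourier_multiplier (\<lambda>k. 1 / (1 + (of_int k)\<^sup>2)) F z"
  unfolding opQ_def by (rule fourier_multiplier_real) simp

lemma of_real_opN:
  "complex_of_real (opN F z) = fourier_multiplier (\<lambda>k. \<i> * of_int k / (1 + (of_int k)\<^sup>2)) F z"
  unfolding opN_def by (rule fourier_multiplier_real) simp

text \<open>
  The Hoelder space is taken on the whole line, since its elements are periodic extensions of class
  \<open>C\<^sup>2\<^sup>,\<^sup>\<alpha>\<close>; the norm is that of the period interval.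
\<close>

definition C2_holder :: "real \<Rightarrow> (real \<Rightarrow> real) set" where
  "C2_holder \<alpha> = {f. (\<forall>x. f differentiable at x) \<and> (\<forall>x. deriv f differentiable at x) \<and>
     (\<exists>K. \<forall>x y. \<bar>deriv (deriv f) x - deriv (deriv f) y\<bar> \<le> K * \<bar>x - y\<bar> powr \<alpha>)}"

definition sup_norm :: "(real \<Rightarrow> real) \<Rightarrow> real" where
  "sup_norm f = (SUP x\<in>{0..2 * pi}. \<bar>f x\<bar>)"

definition holder_seminorm :: "real \<Rightarrow> (real \<Rightarrow> real) \<Rightarrow> real" where
  "holder_seminorm \<alpha> f =
     Sup {\<bar>f x - f y\<bar> / \<bar>x - y\<bar> powr \<alpha> | x y. x \<in> {0..2 * pi} \<and> y \<in> {0..2 * pi} \<and> x \<noteq> y}"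

definition C2_holder_norm :: "real \<Rightarrow> (real \<Rightarrow> real) \<Rightarrow> real" where
  "C2_holder_norm \<alpha> f =
     sup_norm f + sup_norm (deriv f) + sup_norm (deriv (deriv f)) + holder_seminorm \<alpha> (deriv (deriv f))"

text \<open>Index \<open>k\<close> in the series stands for \<open>k + 1\<close>, so that there is no constant term.\<close>

definition X_space :: "real \<Rightarrow> nat \<Rightarrow> (real \<Rightarrow> real) set" where
  "X_space \<alpha> m = {f \<in> C2_holder \<alpha>.
     \<exists>a. \<forall>\<xi>. (\<lambda>k. a (Suc k) * cos (real m * real (Suc k) * \<xi>)) sums f \<xi>}"

definition continuous_curve :: "real \<Rightarrow> real set \<Rightarrow> (real \<Rightarrow> real) \<Rightarrow> (real \<Rightarrow> real \<Rightarrow> real) \<Rightarrow> bool" where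
  "continuous_curve \<alpha> I c \<phi> \<longleftrightarrow> continuous_on I c \<and>
     (\<forall>s\<in>I. ((\<lambda>t. C2_holder_norm \<alpha> (\<lambda>x. \<phi> t x - \<phi> s x)) \<longlongrightarrow> 0) (at s within I))"

text \<open>Classical \<open>2\<pi>\<close>-periodic solutions; \<open>g z t\<close> has the space variable first.\<close>

definition solves_equation :: "(real \<Rightarrow> real \<Rightarrow> real) \<Rightarrow> bool" where
  "solves_equation g \<longleftrightarrow> (\<forall>z t. g (z + 2 * pi) t = g z t) \<and>
     (\<exists>g\<^sub>t g\<^sub>z g\<^sub>z\<^sub>z.
       (\<forall>z t. ((\<lambda>\<tau>. g z \<tau>) has_real_derivative g\<^sub>t z t) (at t)) \<and>
       (\<forall>z t. ((\<lambda>y. g y t) has_real_derivative g\<^sub>z z t) (at z)) \<and>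
       (\<forall>z t. ((\<lambda>y. g\<^sub>z y t) has_real_derivative g\<^sub>z\<^sub>z z t) (at z)) \<and>
       (\<forall>t. continuous_on UNIV (\<lambda>y. g\<^sub>z\<^sub>z y t)) \<and>
       (\<forall>z t. g\<^sub>t z t + 2 * opN (\<lambda>y. g y t) z =
          - opN (\<lambda>y. (g y t)\<^sup>2) z
          + 2 * opQ (\<lambda>y. g\<^sub>z\<^sub>z y t * opN (\<lambda>x. g x t) y - g y t * opN (\<lambda>x. g\<^sub>z\<^sub>z x t) y) z))"

end

theory Submission
  imports Defs
begin

text \<open>
  On the Fourier side the quadratic terms collapse to a bilinear form: a real even profile with
  coefficients \<open>A k\<close> and \<open>A 0 = 0\<close> travels with speed \<open>c\<close> iff
  \<open>(c (1 + k\<^sup>2) - 2) A k = (\<Sum>a. A a * A (k - a) * M a (k - a))\<close> for all \<open>k \<noteq> 0\<close>, where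
  \<open>\<bar>M a b\<bar> \<le> 2 (1 + \<bar>a\<bar>) (1 + \<bar>b\<bar>)\<close>. The form loses one power of \<open>k\<close>, while the linear factor
  gains two. Put \<open>A = s / 2 * H\<close> with \<open>H (\<plusminus>m) = 1\<close>: the equation at \<open>m\<close> determines
  \<open>c = 2 / (1 + m\<^sup>2) + O(s)\<close>, and for this \<open>c\<close> the linear factor stays away from 0 at the other
  multiples of \<open>m\<close>. The remaining equations read \<open>H k = s * R H k\<close>, with \<open>R\<close> bounded and Lipschitz in the
  supremum norm weighted by \<open>(1 + \<bar>k\<bar>) ^ 5\<close>, so for small \<open>s\<close> there is a fixed point, which
  is Lipschitz in \<open>s\<close>. The coefficient \<open>s / 2\<close> at frequency \<open>m\<close> makes the curve injective.
\<close>

no_notation Infinite_Set_Sum.abs_summable_on (infix "abs'_summable'_on" 50)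

section \<open>Fixed points of maps with a small factor\<close>

text \<open>The contraction principle in the unit ball of the supremum norm: for small
  \<open>s\<close> the map \<open>s * R\<close> sends the ball to itself and halves distances. When
  the equations for two parameters are compared, the contracting part is absorbed, which leaves a
  multiple of the change in \<open>s\<close>.\<close>

lemma small_parameter_fixed_points:
  fixes R :: "(nat \<Rightarrow> real) \<Rightarrow> nat \<Rightarrow> real"
  assumes bound: "\<And>x j. (\<And>i. \<bar>x i\<bar> \<le> 1) \<Longrightarrow> \<bar>R x j\<bar> \<le> K"
    and lip: "\<And>x y e j. (\<And>i. \<bar>x i\<bar> \<le> 1) \<Longrightarrow> (\<And>i. \<bar>y i\<bar> \<le> 1) \<Longrightarrow>
                (\<And>i. \<bar>x i - y i\<bar> \<le> e) \<Longrightarrow> \<bar>R x j - R y j\<bar> \<le> L * e"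
  shows "\<exists>\<epsilon>>0. \<exists>X. \<forall>s\<in>{0<..\<epsilon>}.
           (\<forall>j. \<bar>X s j\<bar> \<le> 1 \<and> X s j = s * R (X s) j) \<and>
           (\<forall>t\<in>{0<..\<epsilon>}. \<forall>j. \<bar>X s j - X t j\<bar> \<le> 2 * K * \<bar>s - t\<bar>)"
proof -
  have K: "0 \<le> K"
    using bound[of "\<lambda>_. 0" 0] by simp
  have L: "0 \<le> L"
    using lip[of "\<lambda>_. 0" "\<lambda>_. 0" 1 0] by simp
  \<comment> \<open>One choice serves \<open>\<epsilon> * K \<le> 1\<close>, for invariance of the
    unit ball, and \<open>\<epsilon> * L \<le> 1 / 2\<close>, for contraction; the summand 1 covers
    \<open>K = L = 0\<close>.\<close>
  define \<epsilon> where "\<epsilon> = 1 / (2 * (1 + K + L))"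
  have \<epsilon>: "\<epsilon> > 0" "\<epsilon> * K \<le> 1" "\<epsilon> * L \<le> 1 / 2"
    using K L by (auto simp: \<epsilon>_def field_simps)
  have "\<exists>x. (\<forall>j. \<bar>x j\<bar> \<le> 1) \<and> (\<forall>j. x j = s * R x j)" if s: "s \<in> {0<..\<epsilon>}" for s
  proof -
    have sK: "s * K \<le> 1"
      using s \<epsilon>(2) mult_right_mono[of s \<epsilon> K] K by simp
    have sL: "s * L \<le> 1 / 2"
      using s \<epsilon>(3) mult_right_mono[of s \<epsilon> L] L by simp
    define u where "u n = ((\<lambda>x j. s * R x j) ^^ n) (\<lambda>_. 0)" for n
    have u_Suc: "u (Suc n) = (\<lambda>j. s * R (u n) j)" for n
      by (simp add: u_def)
    have u_le: "\<bar>u n i\<bar> \<le> 1" for n i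
    proof (induction n arbitrary: i)
      case (Suc n)
      have "\<bar>s * R (u n) i\<bar> \<le> s * K"
        using s bound[of "u n" i] Suc by (simp add: abs_mult)
      then show ?case
        using sK by (simp add: u_Suc)
    qed (simp add: u_def)
    have contract: "\<bar>s * R x j - s * R y j\<bar> \<le> e / 2"
      if "\<And>i. \<bar>x i\<bar> \<le> 1" "\<And>i. \<bar>y i\<bar> \<le> 1" "\<And>i. \<bar>x i - y i\<bar> \<le> e" for x y e j
    proof -
      have "\<bar>s * R x j - s * R y j\<bar> = s * \<bar>R x j - R y j\<bar>"
        using s by (simp add: abs_mult flip: right_diff_distrib)
      also have "\<dots> \<le> s * (L * e)"
        using s lip[OF that] by (intro mult_left_mono) auto
      also have "\<dots> \<le> 1 / 2 * e"
        unfolding mult.assoc[symmetric] using sL that(3)[of 0] by (intro mult_right_mono) auto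
      finally show ?thesis by simp
    qed
    have step: "\<bar>u (Suc n) i - u n i\<bar> \<le> (1 / 2) ^ n" for n i
    proof (induction n arbitrary: i)
      case 0
      show ?case
        using u_le[of 1 i] by (simp add: u_def)
    next
      case (Suc n)
      have "\<bar>s * R (u (Suc n)) i - s * R (u n) i\<bar> \<le> (1 / 2) ^ n / 2"
        using u_le Suc by (intro contract)
      then show ?case
        by (simp add: u_Suc)
    qed
    \<comment> \<open>The subtracted term makes the bound an exact geometric sum, so that the
      induction on \<open>p\<close> closes.\<close>
    have "\<bar>u (n + p) i - u n i\<bar> \<le> 2 * (1 / 2) ^ n - 2 * (1 / 2) ^ (n + p)" for n p i
    proof (induction p)
      case (Suc p)
      then show ?case
        using step[of "n + p" i] by simp
    qed simp
    then have tail: "\<bar>u (n + p) i - u n i\<bar> \<le> 2 * (1 / 2) ^ n" for n p i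
      by (rule order_trans) simp
    have "convergent (\<lambda>n. u n i)" for i
    proof -
      have "summable (\<lambda>n. u (Suc n) i - u n i)"
        using step[of _ i] by (intro summable_comparison_test'[OF summable_geometric[of "1 / 2"]]) auto
      then show ?thesis
        using convergent_add[OF _ convergent_const[of "u 0 i"], of "\<lambda>n. u n i - u 0 i"]
        by (simp add: summable_iff_convergent sum_lessThan_telescope[of "\<lambda>n. u n i"])
    qed
    then obtain x where x: "\<And>i. (\<lambda>n. u n i) \<longlonglongrightarrow> x i"
      unfolding convergent_def by metis
    have x_le: "\<bar>x i\<bar> \<le> 1" for i
      by (rule LIMSEQ_le_const2[OF tendsto_rabs[OF x]]) (use u_le in auto)
    \<comment> \<open>The bound is uniform in \<open>i\<close>, as the third premise of
      \<open>contract\<close> demands; convergence of each coordinate alone would not do.\<close>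
    have x_u: "\<bar>x i - u n i\<bar> \<le> 2 * (1 / 2) ^ n" for n i
    proof (rule LIMSEQ_le_const2)
      show "(\<lambda>p. \<bar>u (n + p) i - u n i\<bar>) \<longlonglongrightarrow> \<bar>x i - u n i\<bar>"
        using LIMSEQ_ignore_initial_segment[OF x[of i], of n]
        by (intro tendsto_intros) (simp add: add.commute)
    qed (use tail in auto)
    have "(\<lambda>n. u (Suc n) j - s * R x j) \<longlonglongrightarrow> 0" for j
    proof (rule tendsto_0_le[where K = 1])
      show "(\<lambda>n. (1 / 2 :: real) ^ n) \<longlonglongrightarrow> 0"
        by (intro LIMSEQ_realpow_zero) auto
      have "\<bar>s * R (u n) j - s * R x j\<bar> \<le> 2 * (1 / 2) ^ n / 2" for n
        using u_le x_le x_u by (intro contract) (auto simp: abs_minus_commute)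
      then show "\<forall>\<^sub>F n in sequentially. norm (u (Suc n) j - s * R x j) \<le> norm ((1 / 2 :: real) ^ n) * 1"
        by (simp add: u_Suc)
    qed
    moreover have "(\<lambda>n. u (Suc n) j - s * R x j) \<longlonglongrightarrow> x j - s * R x j" for j
      using LIMSEQ_Suc[OF x[of j]] by (intro tendsto_intros)
    ultimately have "x j = s * R x j" for j
      using LIMSEQ_unique by fastforce
    with x_le show ?thesis by blast
  qed
  then obtain X where X: "\<And>s j. s \<in> {0<..\<epsilon>} \<Longrightarrow> \<bar>X s j\<bar> \<le> 1"
      "\<And>s j. s \<in> {0<..\<epsilon>} \<Longrightarrow> X s j = s * R (X s) j"
    by metis
  have "\<bar>X s j - X t j\<bar> \<le> 2 * K * \<bar>s - t\<bar>" if s: "s \<in> {0<..\<epsilon>}" and t: "t \<in> {0<..\<epsilon>}" for s t j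
  proof -
    \<comment> \<open>Finite, as both fixed points lie in the unit ball. The estimate below improves
      itself: it gives \<open>d \<le> \<bar>s - t\<bar> * K + d / 2\<close>.\<close>
    define d where "d = (SUP i. \<bar>X s i - X t i\<bar>)"
    have "\<bar>X s i - X t i\<bar> \<le> 2" for i
      using X(1)[OF s, of i] X(1)[OF t, of i] by linarith
    then have bdd: "bdd_above (range (\<lambda>i. \<bar>X s i - X t i\<bar>))"
      by (auto intro!: bdd_aboveI)
    then have le_d: "\<bar>X s i - X t i\<bar> \<le> d" for i
      unfolding d_def by (rule cSUP_upper[OF UNIV_I])
    have tL: "t * L \<le> 1 / 2"
      using t \<epsilon>(3) mult_right_mono[of t \<epsilon> L] L by simp
    have "\<bar>X s i - X t i\<bar> \<le> \<bar>s - t\<bar> * K + d / 2" for i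
    proof -
      have "X s i - X t i = (s - t) * R (X s) i + t * (R (X s) i - R (X t) i)"
        using X(2)[OF s, of i] X(2)[OF t, of i] by (simp add: algebra_simps)
      also have "\<bar>\<dots>\<bar> \<le> \<bar>s - t\<bar> * K + t * (L * d)"
      proof (intro order_trans[OF abs_triangle_ineq] add_mono)
        show "\<bar>(s - t) * R (X s) i\<bar> \<le> \<bar>s - t\<bar> * K"
          using bound[of "X s" i] X(1)[OF s] by (simp add: abs_mult mult_left_mono)
        show "\<bar>t * (R (X s) i - R (X t) i)\<bar> \<le> t * (L * d)"
          using t lip[of "X s" "X t" d i] X(1)[OF s] X(1)[OF t] le_d
          by (simp add: abs_mult)
      qed
      also have "t * (L * d) \<le> d / 2"
        using mult_right_mono[OF tL, of d] le_d[of 0] by (simp add: mult.assoc)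
      finally show ?thesis by simp
    qed
    then have "d \<le> \<bar>s - t\<bar> * K + d / 2"
      unfolding d_def by (intro cSUP_least) auto
    then show ?thesis
      using le_d[of j] by (simp add: mult_ac)
  qed
  then show ?thesis
    using X \<epsilon>(1) by blast
qed

subsection \<open>Absolutely convergent Fourier series\<close>

definition fourier_series :: "(int \<Rightarrow> complex) \<Rightarrow> real \<Rightarrow> complex" where
  "fourier_series A x = (\<Sum>\<^sub>\<infinity>k. A k * cis (of_int k * x))"

lemma fourier_series_abs_summable:
  assumes "A abs_summable_on UNIV"
  shows "(\<lambda>k. A k * cis (of_int k * x)) abs_summable_on UNIV"
  using assms by (simp add: norm_mult)

lemma fourier_series_has_sum:
  assumes "A abs_summable_on UNIV"
  shows "((\<lambda>k. A k * cis (of_int k * x)) has_sum fourier_series A x) UNIV"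
  unfolding fourier_series_def
  by (rule has_sum_infsum[OF abs_summable_summable[OF fourier_series_abs_summable[OF assms]]])

lemma norm_fourier_series_le:
  assumes "A abs_summable_on UNIV"
  shows "norm (fourier_series A x) \<le> (\<Sum>\<^sub>\<infinity>k. norm (A k))"
  using norm_infsum_bound[OF fourier_series_abs_summable[OF assms, of x]]
  by (simp add: fourier_series_def norm_mult)

lemma fourier_series_add:
  assumes "A abs_summable_on UNIV" "B abs_summable_on UNIV"
  shows "fourier_series (\<lambda>k. A k + B k) x = fourier_series A x + fourier_series B x"
  using infsum_add[OF abs_summable_summable abs_summable_summable,
      OF fourier_series_abs_summable fourier_series_abs_summable, OF assms, of x x]
  by (simp add: fourier_series_def distrib_right)

lemma fourier_series_cmult:
  "fourier_series (\<lambda>k. c * A k) x = c * fourier_series A x"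
  unfolding fourier_series_def by (simp add: mult.assoc infsum_cmult_right')

lemma fourier_series_diff:
  assumes "A abs_summable_on UNIV" "B abs_summable_on UNIV"
  shows "fourier_series (\<lambda>k. A k - B k) x = fourier_series A x - fourier_series B x"
proof -
  have "(\<lambda>k. - 1 * B k) abs_summable_on UNIV"
    using assms(2) by simp
  then show ?thesis
    using fourier_series_add[OF assms(1), of "\<lambda>k. - 1 * B k"] fourier_series_cmult[of "- 1" B]
    by simp
qed

lemma fourier_series_shift:
  "fourier_series A (x - \<sigma>) = fourier_series (\<lambda>k. A k * cis (- (of_int k * \<sigma>))) x"
  unfolding fourier_series_def by (simp add: cis_mult mult.assoc right_diff_distrib add.commute)

lemma abs_summable_product_Times:
  fixes A B :: "int \<Rightarrow> complex"
  assumes "A abs_summable_on UNIV" "B abs_summable_on UNIV"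
  shows "(\<lambda>(a, b). A a * B b) abs_summable_on UNIV"
  using assms Infinite_Sum.abs_summable_on_Sigma_iff[of "\<lambda>(a, b). A a * B b" UNIV "\<lambda>_. UNIV"]
  by (simp add: norm_mult infsum_cmult_right' infsum_nonneg abs_mult summable_on_cmult_right summable_on_cmult_left)

section \<open>Products of Fourier series\<close>

definition convolution :: "(int \<Rightarrow> complex) \<Rightarrow> (int \<Rightarrow> complex) \<Rightarrow> int \<Rightarrow> complex" where
  "convolution A B k = (\<Sum>\<^sub>\<infinity>a. A a * B (k - a))"

text \<open>The shear from \<open>(k, a)\<close> to \<open>(a, k - a)\<close> is a bijection that
  carries the product family to this one. Summability of the rows and of their sums then follows by
  Fubini.\<close>

lemma abs_summable_convolution_pairs:
  fixes A B :: "int \<Rightarrow> complex"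
  assumes "A abs_summable_on UNIV" "B abs_summable_on UNIV"
  shows "(\<lambda>(k, a). A a * B (k - a)) abs_summable_on UNIV"
proof -
  have "bij_betw (\<lambda>(k, a). (a, k - a)) UNIV (UNIV :: (int \<times> int) set)"
    by (rule bij_betwI[where g = "\<lambda>(a, b). (a + b, a)"]) auto
  from summable_on_reindex_bij_betw[OF this, of "\<lambda>p. norm (case p of (a, b) \<Rightarrow> A a * B b)"]
    abs_summable_product_Times[OF assms]
  show ?thesis
    by (simp add: case_prod_unfold)
qed

lemma convolution_summand_abs_summable:
  fixes A B :: "int \<Rightarrow> complex"
  assumes "A abs_summable_on UNIV" "B abs_summable_on UNIV"
  shows "(\<lambda>a. A a * B (k - a)) abs_summable_on UNIV"
  using abs_summable_convolution_pairs[OF assms]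
    Infinite_Sum.abs_summable_on_Sigma_iff[of "\<lambda>(k, a). A a * B (k - a)" UNIV "\<lambda>_. UNIV"] by simp

lemma convolution_abs_summable:
  assumes "A abs_summable_on UNIV" "B abs_summable_on UNIV"
  shows "(\<lambda>k. convolution A B k) abs_summable_on UNIV"
proof (rule Infinite_Sum.abs_summable_on_comparison_test)
  show "(\<lambda>k. \<Sum>\<^sub>\<infinity>a. norm (A a * B (k - a))) abs_summable_on UNIV"
    using abs_summable_convolution_pairs[OF assms]
    Infinite_Sum.abs_summable_on_Sigma_iff[of "\<lambda>(k, a). A a * B (k - a)" UNIV "\<lambda>_. UNIV"] by simp
  show "norm (convolution A B k) \<le> norm (\<Sum>\<^sub>\<infinity>a. norm (A a * B (k - a)))" for k
    using norm_infsum_bound[OF convolution_summand_abs_summable[OF assms, of k]]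
    by (simp add: convolution_def infsum_nonneg)
qed

text \<open>The Cauchy product, grouped by the total frequency \<open>k\<close>; absolute
  summability over pairs justifies the exchange of sums.\<close>

lemma fourier_series_mult:
  assumes A: "A abs_summable_on UNIV" and B: "B abs_summable_on UNIV"
  shows "fourier_series A x * fourier_series B x = fourier_series (convolution A B) x"
proof -
  let ?A = "\<lambda>k. A k * cis (of_int k * x)" and ?B = "\<lambda>k. B k * cis (of_int k * x)"
  note AB = fourier_series_abs_summable[OF A, of x] fourier_series_abs_summable[OF B, of x]
  have "fourier_series A x * fourier_series B x = (\<Sum>\<^sub>\<infinity>a. \<Sum>\<^sub>\<infinity>b. ?A a * ?B b)"
    by (simp add: fourier_series_def infsum_cmult_right' infsum_cmult_left')
  also have "\<dots> = (\<Sum>\<^sub>\<infinity>a. \<Sum>\<^sub>\<infinity>k. ?A a * ?B (k - a))"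
  proof (rule infsum_cong)
    show "(\<Sum>\<^sub>\<infinity>b. ?A a * ?B b) = (\<Sum>\<^sub>\<infinity>k. ?A a * ?B (k - a))" for a
      by (rule infsum_reindex_bij_betw[symmetric])
        (rule bij_betwI[where g = "\<lambda>b. b + a"], auto)
  qed
  also have "\<dots> = (\<Sum>\<^sub>\<infinity>k. \<Sum>\<^sub>\<infinity>a. ?A a * ?B (k - a))"
    using abs_summable_summable[OF abs_summable_convolution_pairs[OF AB]]
    by (intro infsum_swap_banach[symmetric]) simp
  also have "\<dots> = fourier_series (convolution A B) x"
    unfolding fourier_series_def convolution_def
  proof (rule infsum_cong)
    fix k
    have "cis (of_int a * x) * cis (of_int (k - a) * x) = cis (of_int k * x)" for a
      by (simp add: cis_mult algebra_simps)
    then have "?A a * ?B (k - a) = A a * B (k - a) * cis (of_int k * x)" for a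
      by (metis mult.assoc mult.left_commute)
    then show "(\<Sum>\<^sub>\<infinity>a. ?A a * ?B (k - a)) = (\<Sum>\<^sub>\<infinity>a. A a * B (k - a)) * cis (of_int k * x)"
      by (simp only: infsum_cmult_left')
  qed
  finally show ?thesis .
qed

section \<open>Termwise differentiation and integration\<close>

lemma cis_has_vector_derivative:
  "((\<lambda>x. cis (a * x)) has_vector_derivative \<i> * a * cis (a * x)) (at x within S)"
  by (auto simp: has_vector_derivative_def scaleR_conv_of_real intro!: derivative_eq_intros)

text \<open>The M-test with majorant \<open>norm (of_int k * A k)\<close> makes the differentiated
  series converge uniformly.\<close>

lemma fourier_series_has_vector_derivative:
  assumes A: "A abs_summable_on UNIV" and kA: "(\<lambda>k. of_int k * A k) abs_summable_on UNIV"
  shows "(fourier_series A has_vector_derivative fourier_series (\<lambda>k. \<i> * of_int k * A k) x) (at x)"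
proof -
  \<comment> \<open>\<open>int_decode\<close> lists the integers as a sequence, the form in which
    \<open>has_derivative_series\<close> applies; absolute convergence makes the order
    irrelevant.\<close>
  let ?f = "\<lambda>n x. A (int_decode n) * cis (of_int (int_decode n) * x)"
  let ?f' = "\<lambda>n x. \<i> * of_int (int_decode n) * A (int_decode n) * cis (of_int (int_decode n) * x)"
  have sums: "(\<lambda>n. B (int_decode n) * cis (of_int (int_decode n) * x)) sums fourier_series B x"
    if "B abs_summable_on UNIV" for B x
    using fourier_series_has_sum[OF that, of x]
    has_sum_reindex_bij_betw[OF bij_int_decode, of "\<lambda>k. B k * cis (of_int k * x)"]
    by (intro has_sum_imp_sums) simp
  have kA': "(\<lambda>k. \<i> * of_int k * A k) abs_summable_on UNIV"
    using kA by (simp add: norm_mult)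
  have "summable (\<lambda>n. norm (of_int (int_decode n) * A (int_decode n)))"
    using kA summable_on_reindex_bij_betw[OF bij_int_decode, of "\<lambda>k. norm (of_int k * A k)"]
    by (intro summable_on_imp_summable) auto
  then have lim: "uniform_limit UNIV (\<lambda>n x. \<Sum>i<n. ?f' i x) (\<lambda>x. \<Sum>i. ?f' i x) sequentially"
    by (intro Weierstrass_m_test) (auto simp: norm_mult)
  have eq: "(\<Sum>i. ?f' i x) = fourier_series (\<lambda>k. \<i> * of_int k * A k) x" for x
    using sums[OF kA', of x] by (rule sums_unique[symmetric])
  let ?g' = "\<lambda>x h. h *\<^sub>R fourier_series (\<lambda>k. \<i> * of_int k * A k) x"
  have "\<exists>g. \<forall>x\<in>UNIV. (\<lambda>n. ?f n x) sums g x \<and> (g has_derivative ?g' x) (at x within UNIV)"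
  proof (rule has_derivative_series[where f' = "\<lambda>n x h. h *\<^sub>R ?f' n x" and x = 0])
    show "(?f n has_derivative (\<lambda>h. h *\<^sub>R ?f' n x)) (at x within UNIV)" for n x
      using has_vector_derivative_mult_right[OF cis_has_vector_derivative, of "A (int_decode n)" "of_int (int_decode n)" x UNIV]
      by (simp add: has_vector_derivative_def mult_ac)
    fix e :: real assume "e > 0"
    with lim have "\<forall>\<^sub>F n in sequentially. \<forall>x\<in>UNIV. dist (\<Sum>i<n. ?f' i x) (\<Sum>i. ?f' i x) < e"
      by (rule uniform_limitD)
    then show "\<forall>\<^sub>F n in sequentially. \<forall>x\<in>UNIV. \<forall>h. norm ((\<Sum>i<n. h *\<^sub>R ?f' i x) - ?g' x h) \<le> e * norm h"
    proof eventually_elim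
      case (elim n)
      show ?case
      proof (intro ballI allI)
        fix x h :: real
        have "norm ((\<Sum>i<n. h *\<^sub>R ?f' i x) - ?g' x h) = \<bar>h\<bar> * dist (\<Sum>i<n. ?f' i x) (\<Sum>i. ?f' i x)"
          unfolding eq dist_norm by (simp add: flip: scaleR_sum_right scaleR_diff_right)
        also have "\<dots> \<le> \<bar>h\<bar> * e"
          using elim by (intro mult_left_mono) (auto intro: less_imp_le)
        finally show "norm ((\<Sum>i<n. h *\<^sub>R ?f' i x) - ?g' x h) \<le> e * norm h"
          by (simp add: mult.commute)
      qed
    qed
  qed (use sums[OF A, of 0] in auto)
  then obtain g where g: "\<And>x. (\<lambda>n. ?f n x) sums g x" "\<And>x. (g has_derivative ?g' x) (at x)"
    by auto
  have "g = fourier_series A"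
    using sums_unique2[OF g(1) sums[OF A]] by auto
  then show ?thesis
    using g(2)[of x] by (simp add: has_vector_derivative_def)
qed

lemma fourier_series_continuous:
  assumes "A abs_summable_on UNIV"
  shows "continuous_on S (fourier_series A)"
proof -
  have "uniform_limit S (\<lambda>X y. \<Sum>k\<in>X. A k * cis (of_int k * y)) (fourier_series A) (finite_subsets_at_top UNIV)"
    unfolding fourier_series_def
    using assms by (intro Weierstrass_m_test_general[where M = "\<lambda>k. norm (A k)"]) (auto simp: norm_mult)
  then show ?thesis
    by (rule uniform_limit_theorem[rotated]) (auto intro!: always_eventually continuous_intros)
qed

lemma integral_cis_period:
  "((\<lambda>x. cis (of_int k * x)) has_integral (if k = 0 then 2 * pi else 0)) {0..2 * pi}"
proof (cases "k = 0")
  case True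
  then show ?thesis
    using has_integral_const_real[of "1 :: complex" 0 "2 * pi"] by (simp add: scaleR_conv_of_real)
next
  case False
  have "((\<lambda>x. cis (of_int k * x)) has_integral
      cis (of_int k * (2 * pi)) / (\<i> * of_int k) - cis (of_int k * 0) / (\<i> * of_int k)) {0..2 * pi}"
    using False
    by (intro fundamental_theorem_of_calculus has_vector_derivative_eq_rhs[OF has_vector_derivative_divide[OF cis_has_vector_derivative]])
      auto
  moreover have "cis (of_int k * (2 * pi)) = 1"
    using cos_int_2pin[of k] sin_int_2pin[of k] by (simp add: complex_eq_iff mult_ac)
  ultimately show ?thesis
    using False by simp
qed

text \<open>Uniform convergence permits integration term by term, and orthogonality leaves only the
  term \<open>j = k\<close>.\<close>

lemma fourier_coeff_fourier_series:
  assumes A: "A abs_summable_on UNIV"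
    and F: "\<And>x. complex_of_real (F x) = fourier_series A x"
  shows "fourier_coeff F k = A k"
proof -
  let ?f = "\<lambda>j x. A j * cis (of_int j * x) * cis (- (of_int k * x))"
  have lim: "uniform_limit {0..2 * pi} (\<lambda>X x. \<Sum>j\<in>X. ?f j x) (\<lambda>x. \<Sum>\<^sub>\<infinity>j. ?f j x)
      (finite_subsets_at_top UNIV)"
    using A by (intro Weierstrass_m_test_general[where M = "\<lambda>k. norm (A k)"]) (auto simp: norm_mult)
  have eq: "(\<Sum>\<^sub>\<infinity>j. ?f j x) = complex_of_real (F x) * cis (- (of_int k * x))" for x
    by (simp add: F fourier_series_def infsum_cmult_left')
  have f: "(?f j has_integral (if j = k then 2 * pi * A k else 0)) {0..2 * pi}" for j
  proof -
    have "?f j = (\<lambda>x. A j * cis (of_int (j - k) * x))"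
      by (auto simp: cis_mult algebra_simps)
    then show ?thesis
      using has_integral_mult_right[OF integral_cis_period[of "j - k"], of "A j"]
      by (auto simp: mult.commute split: if_splits)
  qed
  obtain I J where I: "\<And>X. ((\<lambda>x. \<Sum>j\<in>X. ?f j x) has_integral I X) {0..2 * pi}"
    and J: "((\<lambda>x. \<Sum>\<^sub>\<infinity>j. ?f j x) has_integral J) {0..2 * pi}"
    and IJ: "(I \<longlongrightarrow> J) (finite_subsets_at_top UNIV)"
    by (rule uniform_limit_integral[OF lim]) (auto intro!: continuous_intros)
  \<comment> \<open>A finite partial sum that contains \<open>k\<close> already has the final
    integral, so \<open>I\<close> is eventually constant.\<close>
  have "I X = 2 * pi * A k" if "finite X" "k \<in> X" for X
    using has_integral_unique[OF I[of X] has_integral_sum[OF that(1) f]] that by simp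
  then have "eventually (\<lambda>X. I X = 2 * pi * A k) (finite_subsets_at_top UNIV)"
    by (auto simp: eventually_finite_subsets_at_top intro!: exI[of _ "{k}"])
  then have "(I \<longlongrightarrow> 2 * pi * A k) (finite_subsets_at_top UNIV)"
    by (rule tendsto_eventually)
  then have "J = 2 * pi * A k"
    using IJ tendsto_unique[OF finite_subsets_at_top_neq_bot] by blast
  then show ?thesis
    using integral_unique[OF J] by (simp add: fourier_coeff_def eq)
qed

text \<open>A translation multiplies coefficients by phases and so commutes with multipliers. With
  \<open>\<sigma> = c * t\<close> this evaluates the operators on a moving profile.\<close>

lemma fourier_multiplier_fourier_series:
  assumes A: "A abs_summable_on UNIV"
    and F: "\<And>x. complex_of_real (F x) = fourier_series A (x - \<sigma>)"
  shows "fourier_multiplier \<mu> F z = fourier_series (\<lambda>k. \<mu> k * A k) (z - \<sigma>)"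
proof -
  have "fourier_coeff F k = A k * cis (- (of_int k * \<sigma>))" for k
  proof (rule fourier_coeff_fourier_series)
    show "complex_of_real (F x) = fourier_series (\<lambda>k. A k * cis (- (of_int k * \<sigma>))) x" for x
      unfolding F by (rule fourier_series_shift)
  qed (use A in \<open>simp add: norm_mult\<close>)
  then have "fourier_multiplier \<mu> F z = fourier_series (\<lambda>k. \<mu> k * A k * cis (- (of_int k * \<sigma>))) z"
    unfolding fourier_multiplier_def by (simp add: fourier_series_def mult.assoc)
  then show ?thesis
    by (simp only: fourier_series_shift)
qed

subsection \<open>The equation for the Fourier coefficients\<close>

lemma summable_on_int_if_even:
  fixes f :: "int \<Rightarrow> real"
  assumes even: "\<And>k. f (- k) = f k" and f: "(\<lambda>n. f (int n)) summable_on UNIV"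
  shows "f summable_on UNIV"
proof -
  have "f summable_on range int"
    using f by (subst summable_on_reindex) (auto simp: o_def)
  moreover have "f summable_on range (\<lambda>n. - int n)"
    using f even by (subst summable_on_reindex) (auto simp: o_def inj_on_def)
  moreover have "(UNIV :: int set) = range int \<union> range (\<lambda>n. - int n)"
    by (auto simp: image_iff) (metis int_cases2)
  ultimately show ?thesis
    by (metis summable_on_union)
qed

lemma weight_summable:
  assumes "2 \<le> p"
  shows "(\<lambda>k::int. 1 / (1 + \<bar>real_of_int k\<bar>) ^ p) summable_on UNIV"
proof (rule summable_on_int_if_even)
  have "summable (\<lambda>n. 1 / (1 + real n) ^ p)"
    using inverse_power_summable[of p, where 'a = real] assms summable_Suc_iff[of "\<lambda>n. inverse (real n ^ p)"]
    by (simp add: field_simps)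
  then show "(\<lambda>n. 1 / (1 + \<bar>real_of_int (int n)\<bar>) ^ p) summable_on UNIV"
    by (simp add: summable_on_UNIV_nonneg_real_iff)
qed auto

text \<open>One of \<open>a\<close> and \<open>k - a\<close> has at least half the size of
  \<open>k\<close>, so its weight is at most \<open>2 ^ p\<close> times that of \<open>k\<close>;
  the other weight stays as a factor.\<close>

lemma weight_mult_le:
  fixes a k :: int
  shows "1 / (1 + \<bar>real_of_int a\<bar>) ^ p * (1 / (1 + \<bar>real_of_int (k - a)\<bar>) ^ p)
    \<le> 2 ^ p / (1 + \<bar>real_of_int k\<bar>) ^ p *
        (1 / (1 + \<bar>real_of_int a\<bar>) ^ p + 1 / (1 + \<bar>real_of_int (k - a)\<bar>) ^ p)"
proof -
  have le: "1 / (1 + \<bar>real_of_int a\<bar>) ^ p \<le> 2 ^ p / (1 + \<bar>real_of_int k\<bar>) ^ p"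
    if "\<bar>k - a\<bar> \<le> \<bar>a\<bar>" for a
  proof -
    have "1 + \<bar>real_of_int k\<bar> \<le> 2 * (1 + \<bar>real_of_int a\<bar>)"
      using that by (simp add: abs_if split: if_splits)
    then have "(1 + \<bar>real_of_int k\<bar>) ^ p \<le> (2 * (1 + \<bar>real_of_int a\<bar>)) ^ p"
      by (intro power_mono) auto
    then show ?thesis
      unfolding power_mult_distrib by (simp add: divide_simps add_pos_nonneg)
  qed
  have prod_le: "x * y \<le> c * (x + y)" if "0 \<le> x" "0 \<le> y" "x \<le> c \<or> y \<le> c" for x y c :: real
    using that mult_right_mono[of x c y] mult_left_mono[of y c x]
    by (smt (verit) mult.commute mult_nonneg_nonneg ring_class.ring_distribs(1))
  show ?thesis
  proof (rule prod_le)
    show "1 / (1 + \<bar>real_of_int a\<bar>) ^ p \<le> 2 ^ p / (1 + \<bar>real_of_int k\<bar>) ^ p \<or>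
      1 / (1 + \<bar>real_of_int (k - a)\<bar>) ^ p \<le> 2 ^ p / (1 + \<bar>real_of_int k\<bar>) ^ p"
      using le[of a] le[of "k - a"] by (cases "\<bar>k - a\<bar> \<le> \<bar>a\<bar>") auto
  qed auto
qed

section \<open>The interaction kernel and the quadratic form\<close>

text \<open>The 1 stems from \<open>opN\<close> of the square, the fraction from the
  \<open>opQ\<close> term after symmetrisation. The common factor
  \<open>\<i> * k / (1 + k\<^sup>2)\<close>, where \<open>k = a + b\<close>, is taken out.\<close>

definition interaction :: "int \<Rightarrow> int \<Rightarrow> real" where
  "interaction a b =
     1 - (of_int a - of_int b)\<^sup>2 * (1 - of_int a * of_int b) / ((1 + (of_int a)\<^sup>2) * (1 + (of_int b)\<^sup>2))"

text \<open>The identity \<open>D = (1 + a * b)\<^sup>2 + (a - b)\<^sup>2\<close> shows that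
  \<open>(a - b)\<^sup>2 / D\<close> is at most 1, so only the growth of \<open>1 - a * b\<close>
  remains.\<close>

lemma interaction_le:
  "\<bar>interaction a b\<bar> \<le> 2 * (1 + \<bar>real_of_int a\<bar>) * (1 + \<bar>real_of_int b\<bar>)"
proof -
  let ?a = "real_of_int a" and ?b = "real_of_int b"
  define D where "D = (1 + ?a\<^sup>2) * (1 + ?b\<^sup>2)"
  have "D = (1 + ?a * ?b)\<^sup>2 + (?a - ?b)\<^sup>2"
    by (simp add: D_def power2_eq_square algebra_simps)
  then have le: "(?a - ?b)\<^sup>2 \<le> D"
    by simp
  have D: "D > 0"
    unfolding D_def by (intro mult_pos_pos add_pos_nonneg) auto
  have "\<bar>(?a - ?b)\<^sup>2 * (1 - ?a * ?b) / D\<bar> = (?a - ?b)\<^sup>2 / D * \<bar>1 - ?a * ?b\<bar>"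
    using D by (simp add: abs_mult)
  also have "\<dots> \<le> 1 * \<bar>1 - ?a * ?b\<bar>"
    using le D by (intro mult_right_mono) auto
  also have "\<dots> \<le> 1 + \<bar>?a\<bar> * \<bar>?b\<bar>"
    using abs_triangle_ineq4[of 1 "?a * ?b"] by (simp add: abs_mult)
  finally have "\<bar>interaction a b\<bar> \<le> 2 + \<bar>?a\<bar> * \<bar>?b\<bar>"
    unfolding interaction_def D_def[symmetric] by linarith
  also have "\<dots> \<le> 2 * (1 + \<bar>?a\<bar>) * (1 + \<bar>?b\<bar>)"
    using mult_nonneg_nonneg[of "\<bar>?a\<bar>" "\<bar>?b\<bar>"] by (simp add: distrib_left distrib_right)
  finally show ?thesis .
qed

text \<open>The half makes \<open>s\<close> itself the small factor: with
  \<open>A = s / 2 * H\<close>, the expression \<open>2 * quad A A k\<close> becomes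
  \<open>s / 2 * (s * quad H H k)\<close>.\<close>

definition quad :: "(int \<Rightarrow> real) \<Rightarrow> (int \<Rightarrow> real) \<Rightarrow> int \<Rightarrow> real" where
  "quad G H k = (\<Sum>\<^sub>\<infinity>a. G a * H (k - a) * interaction a (k - a)) / 2"

text \<open>The power 5 allows three factors of the frequency, two for the second derivative and one
  for its Hoelder bound, and leaves the summable power 2.\<close>

definition dominated :: "real \<Rightarrow> (int \<Rightarrow> real) \<Rightarrow> bool" where
  "dominated C G \<longleftrightarrow> (\<forall>k. \<bar>G k\<bar> \<le> C / (1 + \<bar>real_of_int k\<bar>) ^ 5)"

definition weight_sum :: real where
  "weight_sum = (\<Sum>\<^sub>\<infinity>k::int. 1 / (1 + \<bar>real_of_int k\<bar>) ^ 4)"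

lemma weight_sum_nonneg: "0 \<le> weight_sum"
  unfolding weight_sum_def by (intro infsum_nonneg) auto

lemma dominated_nonneg: "dominated C G \<Longrightarrow> 0 \<le> C"
  unfolding dominated_def by (drule spec[of _ 0]) auto

text \<open>The kernel costs one power in each frequency, from 5 to 4. The constant 32 is
  \<open>2 * 2 ^ 4\<close>, from \<open>interaction_le\<close> and
  \<open>weight_mult_le\<close>.\<close>

lemma quad_summand_le:
  assumes "dominated p G" "dominated q H"
  shows "\<bar>G a * H (k - a) * interaction a (k - a)\<bar> \<le>
    32 * p * q / (1 + \<bar>real_of_int k\<bar>) ^ 4 *
      (1 / (1 + \<bar>real_of_int a\<bar>) ^ 4 + 1 / (1 + \<bar>real_of_int (k - a)\<bar>) ^ 4)"
proof -
  let ?a = "1 + \<bar>real_of_int a\<bar>" and ?b = "1 + \<bar>real_of_int (k - a)\<bar>" and ?k = "1 + \<bar>real_of_int k\<bar>"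
  have pos: "?a > 0" "?b > 0" "?k > 0" by auto
  have pq: "0 \<le> p * q"
    using assms dominated_nonneg by (intro mult_nonneg_nonneg) blast+
  have GH: "\<bar>G a\<bar> \<le> p / ?a ^ 5" "\<bar>H (k - a)\<bar> \<le> q / ?b ^ 5"
    using assms unfolding dominated_def by blast+
  have "\<bar>G a * H (k - a) * interaction a (k - a)\<bar> \<le> (p / ?a ^ 5) * (q / ?b ^ 5) * (2 * ?a * ?b)"
    unfolding abs_mult
    using interaction_le[of a "k - a"] GH dominated_nonneg[OF assms(1)] dominated_nonneg[OF assms(2)]
    by (intro mult_mono mult_nonneg_nonneg) auto
  also have "\<dots> = 2 * (p * q) * (1 / ?a ^ 4 * (1 / ?b ^ 4))"
  proof -
    have "p / x ^ 5 * (q / y ^ 5) * (2 * x * y) = 2 * (p * q) * (1 / x ^ 4 * (1 / y ^ 4))"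
      if "x > 0" "y > 0" for x y :: real
      using that by (simp add: divide_simps) (simp add: eval_nat_numeral)
    then show ?thesis
      using pos by blast
  qed
  also have "\<dots> \<le> 2 * (p * q) * (2 ^ 4 / ?k ^ 4 * (1 / ?a ^ 4 + 1 / ?b ^ 4))"
    using pq by (intro mult_left_mono weight_mult_le) auto
  finally show ?thesis
    by (simp only: times_divide_eq_left times_divide_eq_right mult.assoc) (simp add: mult_ac)
qed

lemma quad_weights_summable:
  "(\<lambda>a. c * (1 / (1 + \<bar>real_of_int a\<bar>) ^ 4 + 1 / (1 + \<bar>real_of_int (k - a)\<bar>) ^ 4)) summable_on UNIV"
  "(\<Sum>\<^sub>\<infinity>a. c * (1 / (1 + \<bar>real_of_int a\<bar>) ^ 4 + 1 / (1 + \<bar>real_of_int (k - a)\<bar>) ^ 4)) = 2 * c * weight_sum"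
proof -
  let ?w = "\<lambda>a::int. 1 / (1 + \<bar>real_of_int a\<bar>) ^ 4"
  have bij: "bij_betw (\<lambda>a. k - a) UNIV (UNIV :: int set)"
    by (rule bij_betwI[where g = "\<lambda>a. k - a"]) auto
  have w: "?w summable_on UNIV"
    by (rule weight_summable) simp
  have wk: "(\<lambda>a. ?w (k - a)) summable_on UNIV"
    using w by (subst summable_on_reindex_bij_betw[OF bij, of ?w])
  have "infsum (\<lambda>a. ?w (k - a)) UNIV = weight_sum"
    unfolding weight_sum_def by (rule infsum_reindex_bij_betw[OF bij])
  then show "(\<Sum>\<^sub>\<infinity>a. c * (?w a + ?w (k - a))) = 2 * c * weight_sum"
    using infsum_add[OF w wk] by (simp add: infsum_cmult_right' weight_sum_def)
  show "(\<lambda>a. c * (?w a + ?w (k - a))) summable_on UNIV"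
    by (intro summable_on_cmult_right summable_on_add w wk)
qed

lemma quad_summand_abs_summable:
  assumes "dominated p G" "dominated q H"
  shows "(\<lambda>a. G a * H (k - a) * interaction a (k - a)) abs_summable_on UNIV"
  by (rule Infinite_Sum.abs_summable_on_comparison_test'[OF quad_weights_summable(1)
        [of "32 * p * q / (1 + \<bar>real_of_int k\<bar>) ^ 4" k]])
    (use quad_summand_le[OF assms, of _ k] in \<open>simp only: real_norm_def\<close>)

lemma quad_le:
  assumes "dominated p G" "dominated q H"
  shows "\<bar>quad G H k\<bar> \<le> 32 * weight_sum * p * q / (1 + \<bar>real_of_int k\<bar>) ^ 4"
proof -
  note abs = quad_summand_abs_summable[OF assms, of k]
  have "\<bar>\<Sum>\<^sub>\<infinity>a. G a * H (k - a) * interaction a (k - a)\<bar> \<le>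
      2 * (32 * p * q / (1 + \<bar>real_of_int k\<bar>) ^ 4) * weight_sum"
    using norm_infsum_bound[OF abs] infsum_mono[OF abs quad_weights_summable(1)] quad_summand_le[OF assms, of _ k]
    unfolding quad_weights_summable(2) real_norm_def by (meson order_trans)
  then show ?thesis
    unfolding quad_def by (simp add: mult_ac)
qed

lemma has_sum_diff:
  fixes f g :: "'a \<Rightarrow> real"
  assumes "(f has_sum a) A" "(g has_sum b) A"
  shows "((\<lambda>x. f x - g x) has_sum (a - b)) A"
  using has_sum_add[OF assms(1), of "\<lambda>x. - g x" "- b"] assms(2) by (simp add: has_sum_uminus)

text \<open>Polarisation: each term on the right contains the difference once, so
  \<open>quad_le\<close> also gives Lipschitz bounds.\<close>

lemma quad_diff:
  assumes "dominated p G" "dominated q H"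
  shows "quad G G k - quad H H k = quad (\<lambda>a. G a - H a) G k + quad H (\<lambda>a. G a - H a) k"
proof -
  have s: "((\<lambda>a. F a * F' (k - a) * interaction a (k - a)) has_sum
      (\<Sum>\<^sub>\<infinity>a. F a * F' (k - a) * interaction a (k - a))) UNIV"
    if "F = G \<or> F = H" "F' = G \<or> F' = H" for F F'
    using that quad_summand_abs_summable[OF assms(1,1)] quad_summand_abs_summable[OF assms]
      quad_summand_abs_summable[OF assms(2,1)] quad_summand_abs_summable[OF assms(2,2)]
    by (auto intro!: has_sum_infsum[OF abs_summable_summable])
  have 1: "quad (\<lambda>a. G a - H a) G k = quad G G k - quad H G k"
    using infsumI[OF has_sum_diff[OF s s, of G G H G]] by (simp add: quad_def left_diff_distrib diff_divide_distrib)
  have 2: "quad H (\<lambda>a. G a - H a) k = quad H G k - quad H H k"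
    using infsumI[OF has_sum_diff[OF s s, of H G H H]]
    by (simp add: quad_def left_diff_distrib right_diff_distrib diff_divide_distrib)
  show ?thesis
    unfolding 1 2 by simp
qed

lemma quad_even:
  assumes "\<And>k. H (- k) = H k"
  shows "quad H H (- k) = quad H H k"
proof -
  have "(\<Sum>\<^sub>\<infinity>a. H a * H (- k - a) * interaction a (- k - a)) =
      (\<Sum>\<^sub>\<infinity>a. H (- a) * H (- k - - a) * interaction (- a) (- k - - a))"
    by (rule infsum_reindex_bij_betw[symmetric]) (rule bij_betwI[where g = uminus], auto)
  also have "\<dots> = (\<Sum>\<^sub>\<infinity>a. H a * H (k - a) * interaction a (k - a))"
  proof (rule infsum_cong)
    fix a
    have "H (- k - - a) = H (k - a)" "interaction (- a) (- k - - a) = interaction a (k - a)"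
      using assms[of "k - a"] by (simp_all add: interaction_def power2_commute algebra_simps)
    then show "H (- a) * H (- k - - a) * interaction (- a) (- k - - a) = H a * H (k - a) * interaction a (k - a)"
      using assms by simp
  qed
  finally show ?thesis
    by (simp add: quad_def)
qed

text \<open>If \<open>m\<close> divides \<open>a\<close> and \<open>k - a\<close>, it divides
  \<open>k\<close>; thus the quadratic term preserves m-fold symmetry.\<close>

lemma quad_eq_0_if_not_dvd:
  assumes "\<And>k. \<not> m dvd k \<Longrightarrow> H k = 0" and "\<not> m dvd k"
  shows "quad H H k = 0"
proof -
  have "H a * H (k - a) = 0" for a
    using assms by (metis diff_add_cancel dvd_add mult_eq_0_iff)
  then have "(\<Sum>\<^sub>\<infinity>a. H a * H (k - a) * interaction a (k - a)) = 0"
    by (intro infsum_0) simp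
  then show ?thesis
    by (simp add: quad_def)
qed

lemma dominated_cmult:
  assumes "dominated C G"
  shows "dominated (\<bar>u\<bar> * C) (\<lambda>k. u * G k)"
  unfolding dominated_def
proof
  show "\<bar>u * G k\<bar> \<le> \<bar>u\<bar> * C / (1 + \<bar>real_of_int k\<bar>) ^ 5" for k
    using mult_left_mono[OF assms[unfolded dominated_def, rule_format, of k], of "\<bar>u\<bar>"] by (simp add: abs_mult)
qed

lemma dominated_add:
  assumes "dominated C G" "dominated D H"
  shows "dominated (C + D) (\<lambda>k. G k + H k)"
  unfolding dominated_def add_divide_distrib
  using assms unfolding dominated_def by (auto intro: order_trans[OF abs_triangle_ineq add_mono])

lemma quad_cmult: "quad (\<lambda>k. u * H k) (\<lambda>k. u * H k) k = u\<^sup>2 * quad H H k"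
proof -
  have "(\<Sum>\<^sub>\<infinity>a. u * H a * (u * H (k - a)) * interaction a (k - a))
      = (\<Sum>\<^sub>\<infinity>a. u\<^sup>2 * (H a * H (k - a) * interaction a (k - a)))"
    by (simp add: power2_eq_square mult_ac)
  then show ?thesis
    by (simp add: quad_def infsum_cmult_right')
qed

text \<open>
  The entry \<open>x m\<close> is not needed for a coefficient, since that of \<open>m\<close> is normalised to 1. It
  holds the speed, as \<open>x m = c (1 + m\<^sup>2) - 2\<close>.
\<close>

definition modes :: "nat \<Rightarrow> (nat \<Rightarrow> real) \<Rightarrow> int \<Rightarrow> real" where
  "modes m x k = (if \<bar>k\<bar> = int m then 1 else x (nat \<bar>k\<bar>) / (1 + \<bar>real_of_int k\<bar>) ^ 5)"

text \<open>The constant comes from the entry 1 at frequency \<open>m\<close>, which is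
  \<open>(1 + m) ^ 5\<close> times the weight there.\<close>

lemma modes_dominated:
  assumes "\<And>i. \<bar>x i\<bar> \<le> 1"
  shows "dominated ((1 + real m) ^ 5) (modes m x)"
  unfolding dominated_def
proof
  fix k
  show "\<bar>modes m x k\<bar> \<le> (1 + real m) ^ 5 / (1 + \<bar>real_of_int k\<bar>) ^ 5"
  proof (cases "\<bar>k\<bar> = int m")
    case True
    then have "\<bar>real_of_int k\<bar> = real m"
      by linarith
    then show ?thesis
      using True by (simp add: modes_def)
  next
    case False
    have "\<bar>x (nat \<bar>k\<bar>)\<bar> \<le> (1 + real m) ^ 5"
      using assms[of "nat \<bar>k\<bar>"] one_le_power[of "1 + real m" 5] by linarith
    then show ?thesis
      using False by (simp add: modes_def divide_right_mono)
  qed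
qed

text \<open>The normalised entries at \<open>m\<close> and \<open>- m\<close> cancel, so no power of
  \<open>1 + m\<close> enters.\<close>

lemma modes_diff_dominated:
  assumes "\<And>i. \<bar>x i - y i\<bar> \<le> e"
  shows "dominated e (\<lambda>k. modes m x k - modes m y k)"
  unfolding dominated_def
proof
  have "0 \<le> e"
    using assms[of 0] by linarith
  then show "\<bar>modes m x k - modes m y k\<bar> \<le> e / (1 + \<bar>real_of_int k\<bar>) ^ 5" for k
    using assms[of "nat \<bar>k\<bar>"]
    by (auto simp: modes_def divide_right_mono simp flip: diff_divide_distrib)
qed

text \<open>
  With \<open>c\<^sub>0 = 2 / (1 + m\<^sup>2)\<close>, the linear factor \<open>c\<^sub>0 (1 + k\<^sup>2) - 2\<close> equals
  \<open>2 (k\<^sup>2 - m\<^sup>2) / (1 + m\<^sup>2)\<close>; \<open>gain\<close> contains its inverse and the weight, and \<open>feedback\<close> accounts for the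
  correction of the speed.
\<close>

definition gain :: "nat \<Rightarrow> nat \<Rightarrow> real" where
  "gain m k = (if k = m then 1 else if m dvd k \<and> m < k
     then (1 + (real m)\<^sup>2) * (1 + real k) ^ 5 / (2 * ((real k)\<^sup>2 - (real m)\<^sup>2)) else 0)"

definition feedback :: "nat \<Rightarrow> nat \<Rightarrow> real" where
  "feedback m k = (if m dvd k \<and> m < k
     then (1 + (real k)\<^sup>2) / (2 * ((real k)\<^sup>2 - (real m)\<^sup>2)) else 0)"

text \<open>A larger multiple of \<open>m\<close> is at least \<open>2 * m\<close>, so
  \<open>m\<^sup>2\<close> is at most a quarter of \<open>k\<^sup>2\<close>. This keeps the linear
  factor away from 0.\<close>

lemma multiple_gap:
  assumes "1 \<le> m" "m dvd k" "m < k"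
  shows "real k + 1 \<le> 2 * ((real k)\<^sup>2 - (real m)\<^sup>2)"
    "1 + (real k)\<^sup>2 \<le> 2 * ((real k)\<^sup>2 - (real m)\<^sup>2)"
proof -
  obtain j where j: "k = m * j"
    using assms by blast
  have "j \<noteq> 0" "j \<noteq> 1"
    using assms(3) j by auto
  then have "2 \<le> j"
    by linarith
  then have "m * 2 \<le> k"
    unfolding j by (rule mult_le_mono2)
  then have km: "2 * real m \<le> real k"
    by linarith
  then have "(2 * real m)\<^sup>2 \<le> (real k)\<^sup>2"
    by (intro power_mono) auto
  then have m2: "4 * (real m)\<^sup>2 \<le> (real k)\<^sup>2"
    by (simp add: power_mult_distrib)
  have k2: "2 \<le> real k"
    using km assms(1) by linarith
  then have "2 * real k \<le> (real k)\<^sup>2"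
    unfolding power2_eq_square by (intro mult_right_mono) auto
  then show "real k + 1 \<le> 2 * ((real k)\<^sup>2 - (real m)\<^sup>2)" "1 + (real k)\<^sup>2 \<le> 2 * ((real k)\<^sup>2 - (real m)\<^sup>2)"
    using m2 k2 by auto
qed

text \<open>Of the two powers in the denominator one is enough: it makes up for the power that the
  interaction costs in \<open>quad_le\<close>.\<close>

lemma gain_le:
  assumes "1 \<le> m"
  shows "0 \<le> gain m k" "gain m k \<le> (1 + (real m)\<^sup>2) * (1 + real k) ^ 4"
proof -
  have "0 \<le> gain m k \<and> gain m k \<le> (1 + (real m)\<^sup>2) * (1 + real k) ^ 4"
  proof (cases "m dvd k \<and> m < k")
    case True
    define D where "D = 2 * ((real k)\<^sup>2 - (real m)\<^sup>2)"
    have D: "1 + real k \<le> D"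
      using multiple_gap(1)[OF assms, of k] True by (simp add: D_def)
    then have "D > 0" by linarith
    have "(1 + (real m)\<^sup>2) * (1 + real k) ^ 5 = (1 + (real m)\<^sup>2) * (1 + real k) ^ 4 * (1 + real k)"
      by (simp add: eval_nat_numeral)
    also have "\<dots> \<le> (1 + (real m)\<^sup>2) * (1 + real k) ^ 4 * D"
      using D by (intro mult_left_mono) auto
    finally show ?thesis
      using True \<open>D > 0\<close> unfolding gain_def D_def[symmetric] by (simp add: divide_le_eq)
  next
    case False
    have "1 \<le> (1 + (real m)\<^sup>2) * (1 + real k) ^ 4"
      using mult_mono[of 1 "1 + (real m)\<^sup>2" 1 "(1 + real k) ^ 4"] by simp
    then show ?thesis
      using False by (auto simp: gain_def)
  qed
  then show "0 \<le> gain m k" "gain m k \<le> (1 + (real m)\<^sup>2) * (1 + real k) ^ 4"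
    by auto
qed

lemma feedback_le:
  assumes "1 \<le> m"
  shows "0 \<le> feedback m k" "feedback m k \<le> 1"
  using multiple_gap[OF assms, of k] by (auto simp: feedback_def divide_simps)

section \<open>The fixed-point map and its estimates\<close>

text \<open>For \<open>m \<ge> 1\<close>, entry \<open>m\<close> yields the correction of the speed.
  At larger multiples of \<open>m\<close> this correction is moved to the right, and the equation is
  divided by the linear factor at \<open>s = 0\<close>. All other entries vanish.\<close>

definition profile_map :: "nat \<Rightarrow> (nat \<Rightarrow> real) \<Rightarrow> nat \<Rightarrow> real" where
  "profile_map m x k = gain m k * quad (modes m x) (modes m x) (int k)
     - feedback m k * quad (modes m x) (modes m x) (int m) * x k"

lemma gain_quad_le:
  assumes "1 \<le> m" and "\<bar>q\<bar> \<le> c / (1 + real k) ^ 4"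
  shows "\<bar>gain m k * q\<bar> \<le> (1 + (real m)\<^sup>2) * c"
proof -
  have "\<bar>gain m k * q\<bar> \<le> ((1 + (real m)\<^sup>2) * (1 + real k) ^ 4) * (c / (1 + real k) ^ 4)"
    unfolding abs_mult using assms gain_le[OF assms(1), of k] by (intro mult_mono) auto
  also have "\<dots> = (1 + (real m)\<^sup>2) * c"
    by (simp add: add_pos_nonneg less_imp_neq[symmetric])
  finally show ?thesis .
qed

lemma quad_modes_le:
  assumes "\<And>i. \<bar>x i\<bar> \<le> 1"
  shows "\<bar>quad (modes m x) (modes m x) (int k)\<bar> \<le> 32 * weight_sum * (1 + real m) ^ 10 / (1 + real k) ^ 4"
  using quad_le[OF modes_dominated[of x m, OF assms] modes_dominated[of x m, OF assms], of "int k"]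
  by (simp add: mult.assoc flip: power_add)

lemma quad_modes_diff_le:
  assumes "\<And>i. \<bar>x i\<bar> \<le> 1" "\<And>i. \<bar>y i\<bar> \<le> 1" "\<And>i. \<bar>x i - y i\<bar> \<le> e"
  shows "\<bar>quad (modes m x) (modes m x) (int k) - quad (modes m y) (modes m y) (int k)\<bar>
    \<le> 64 * weight_sum * (1 + real m) ^ 5 * e / (1 + real k) ^ 4"
proof -
  note x = modes_dominated[of x m, OF assms(1)] and y = modes_dominated[of y m, OF assms(2)]
    and xy = modes_diff_dominated[of x y e m, OF assms(3)]
  define c where "c = 32 * weight_sum * (1 + real m) ^ 5 * e / (1 + real k) ^ 4"
  have "64 * weight_sum * (1 + real m) ^ 5 * e / (1 + real k) ^ 4 = c + c"
    by (simp add: c_def)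
  moreover have "\<bar>quad (\<lambda>a. modes m x a - modes m y a) (modes m x) (int k)\<bar> \<le> c"
    using quad_le[OF xy x, of "int k"] by (simp add: c_def mult_ac)
  moreover have "\<bar>quad (modes m y) (\<lambda>a. modes m x a - modes m y a) (int k)\<bar> \<le> c"
    using quad_le[OF y xy, of "int k"] by (simp add: c_def mult_ac)
  ultimately show ?thesis
    unfolding quad_diff[OF x y] by linarith
qed

lemma le_weighted:
  assumes "\<bar>q\<bar> \<le> c / (1 + real k) ^ 4"
  shows "\<bar>q\<bar> \<le> c"
proof -
  have "1 \<le> (1 + real k) ^ 4" by (rule one_le_power) simp
  then have "\<bar>q\<bar> * 1 \<le> \<bar>q\<bar> * (1 + real k) ^ 4"
    by (intro mult_left_mono) auto
  also have "\<dots> \<le> c"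
    using assms by (simp add: pos_le_divide_eq add_pos_nonneg)
  finally show ?thesis by simp
qed

lemma profile_map_le:
  assumes m: "1 \<le> m" and x: "\<And>i. \<bar>x i\<bar> \<le> 1"
  shows "\<bar>profile_map m x k\<bar> \<le> (2 + (real m)\<^sup>2) * (32 * weight_sum * (1 + real m) ^ 10)"
proof -
  let ?c = "32 * weight_sum * (1 + real m) ^ 10" and ?q = "quad (modes m x) (modes m x)"
  have q: "\<bar>?q (int m)\<bar> \<le> ?c"
    by (rule le_weighted[OF quad_modes_le[OF x]])
  have "\<bar>feedback m k * ?q (int m) * x k\<bar> \<le> 1 * ?c * 1"
    unfolding abs_mult using q x[of k] feedback_le[OF m, of k] weight_sum_nonneg by (intro mult_mono) auto
  moreover have "\<bar>gain m k * ?q (int k)\<bar> \<le> (1 + (real m)\<^sup>2) * ?c"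
    by (rule gain_quad_le[OF m quad_modes_le[OF x]])
  ultimately have "\<bar>profile_map m x k\<bar> \<le> (1 + (real m)\<^sup>2) * ?c + ?c"
    unfolding profile_map_def by linarith
  then show ?thesis
    by (simp add: distrib_right)
qed

text \<open>The feedback is a product, so its difference splits in two. The part with
  \<open>x k - y k\<close> accounts for the last summand of the constant.\<close>

lemma profile_map_diff_le:
  assumes m: "1 \<le> m" and x: "\<And>i. \<bar>x i\<bar> \<le> 1" and y: "\<And>i. \<bar>y i\<bar> \<le> 1"
    and e: "\<And>i. \<bar>x i - y i\<bar> \<le> e"
  shows "\<bar>profile_map m x k - profile_map m y k\<bar>
    \<le> ((2 + (real m)\<^sup>2) * (64 * weight_sum * (1 + real m) ^ 5) + 32 * weight_sum * (1 + real m) ^ 10) * e"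
proof -
  let ?c = "32 * weight_sum * (1 + real m) ^ 10" and ?d = "64 * weight_sum * (1 + real m) ^ 5"
  let ?q = "quad (modes m x) (modes m x)" and ?r = "quad (modes m y) (modes m y)"
  have "0 \<le> e"
    using e[of 0] by linarith
  have q: "\<bar>?q (int m)\<bar> \<le> ?c"
    by (rule le_weighted[OF quad_modes_le[OF x]])
  have qr: "\<bar>?q (int m) - ?r (int m)\<bar> \<le> ?d * e"
    by (rule le_weighted[OF quad_modes_diff_le[OF x y e]])
  have 1: "\<bar>gain m k * (?q (int k) - ?r (int k))\<bar> \<le> (1 + (real m)\<^sup>2) * (?d * e)"
    by (rule gain_quad_le[OF m quad_modes_diff_le[OF x y e]])
  have "\<bar>feedback m k * (?q (int m) * (x k - y k))\<bar> \<le> 1 * (?c * e)"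
    unfolding abs_mult using q e[of k] feedback_le[OF m, of k] weight_sum_nonneg \<open>0 \<le> e\<close> by (intro mult_mono) auto
  moreover have "\<bar>feedback m k * ((?q (int m) - ?r (int m)) * y k)\<bar> \<le> 1 * (?d * e * 1)"
    unfolding abs_mult using qr y[of k] feedback_le[OF m, of k] weight_sum_nonneg \<open>0 \<le> e\<close> by (intro mult_mono) auto
  moreover have "profile_map m x k - profile_map m y k = gain m k * (?q (int k) - ?r (int k))
      - feedback m k * (?q (int m) * (x k - y k)) - feedback m k * ((?q (int m) - ?r (int m)) * y k)"
    by (simp add: profile_map_def algebra_simps)
  ultimately have "\<bar>profile_map m x k - profile_map m y k\<bar> \<le> (1 + (real m)\<^sup>2) * (?d * e) + ?c * e + ?d * e"
    using 1 by linarith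
  then show ?thesis
    by (simp add: algebra_simps)
qed

text \<open>
  The equation of mode \<open>m\<close> is solved by the choice of the speed; it is substituted into the other
  equations, so that no unknown is left in a denominator.
\<close>

lemma profile_equation:
  assumes m: "1 \<le> m" and x: "\<And>j. x j = s * profile_map m x j" and "k \<noteq> 0"
  shows "((2 + x m) / (1 + (real m)\<^sup>2) * (1 + (real_of_int k)\<^sup>2) - 2) * modes m x k
    = s * quad (modes m x) (modes m x) k"
    and "\<not> int m dvd k \<Longrightarrow> modes m x k = 0" and "modes m x 0 = 0"
proof -
  let ?H = "modes m x"
  have x0: "x j = 0" if "\<not> (m dvd j \<and> m \<le> j)" for j
  proof -
    have "profile_map m x j = 0"
      using that by (auto simp: profile_map_def gain_def feedback_def)
    then show ?thesis
      using x[of j] by simp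
  qed
  show "?H 0 = 0"
    using x0[of 0] m by (simp add: modes_def)
  have dvd: "?H k = 0" if "\<not> int m dvd k" for k
    using that x0[of "nat \<bar>k\<bar>"] by (auto simp: modes_def) (metis dvd_abs_iff dvd_refl)+
  then show "\<not> int m dvd k \<Longrightarrow> ?H k = 0" .
  have even: "?H (- k) = ?H k" for k
    by (simp add: modes_def)
  define q where "q n = quad ?H ?H (int n)" for n
  \<comment> \<open>At \<open>m\<close> the gain is 1 and the feedback 0.\<close>
  have xm: "x m = s * q m"
    by (subst x) (simp add: profile_map_def gain_def feedback_def q_def)
  have nat: "((2 + x m) / (1 + (real m)\<^sup>2) * (1 + (real n)\<^sup>2) - 2) * ?H (int n) = s * q n"
    if "n > 0" for n
  proof -
    consider "n = m" | "\<not> m dvd n" | "m dvd n" "n \<noteq> m"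
      by blast
    then show ?thesis
    proof cases
      case 1
      have "1 + (real m)\<^sup>2 \<noteq> 0"
        using zero_le_power2[of "real m"] by linarith
      then have "(2 + x m) / (1 + (real m)\<^sup>2) * (1 + (real m)\<^sup>2) - 2 = x m"
        by simp
      then show ?thesis
        using 1 xm by (simp add: modes_def)
    next
      case 2
      then show ?thesis
        using dvd[of "int n"] quad_eq_0_if_not_dvd[of "int m" ?H "int n"] dvd by (simp add: q_def)
    next
      case 3
      then have 3: "m dvd n" "m < n"
        using dvd_imp_le[of m n] that by simp_all
      define D where "D = (real n)\<^sup>2 - (real m)\<^sup>2"
      define N where "N = 1 + (real n)\<^sup>2"
      define P where "P = 1 + (real m)\<^sup>2"
      define w where "w = (1 + real n) ^ 5"
      have pos: "D > 0" "P > 0" "w > 0"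
        using multiple_gap(1)[OF m 3] by (auto simp: D_def P_def w_def add_pos_nonneg)
      have "x n = s * (P * w / (2 * D) * q n - N / (2 * D) * q m * x n)"
        by (subst x) (use 3 in \<open>simp add: profile_map_def gain_def feedback_def q_def D_def N_def P_def w_def\<close>)
      then have "2 * D * x n = s * P * w * q n - N * (s * q m) * x n"
        using pos(1) by (simp add: field_simps)
      \<comment> \<open>By \<open>xm\<close> the feedback equals \<open>N * x m * x n\<close>, so it
        joins the linear factor on the left.\<close>
      then have "(2 * D + N * x m) * x n = s * P * w * q n"
        unfolding xm by (simp add: algebra_simps)
      \<comment> \<open>Since \<open>D = N - P\<close>; the right-hand side is \<open>P\<close>
        times the linear factor.\<close>
      moreover have "2 * D + N * x m = (2 + x m) * N - 2 * P"
        by (simp add: D_def N_def P_def algebra_simps)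
      ultimately have "((2 + x m) * N - 2 * P) * x n = s * P * w * q n"
        by (simp only:)
      moreover have "((2 + x m) / P * N - 2) * (x n / w) = ((2 + x m) * N - 2 * P) * x n / (P * w)"
        using pos by (simp add: field_simps)
      ultimately have "((2 + x m) / P * N - 2) * (x n / w) = s * q n"
        using pos by simp
      moreover have "?H (int n) = x n / w"
        using 3 by (simp add: modes_def w_def)
      ultimately show ?thesis
        by (simp add: N_def P_def)
    qed
  qed
  show "((2 + x m) / (1 + (real m)\<^sup>2) * (1 + (real_of_int k)\<^sup>2) - 2) * ?H k = s * quad ?H ?H k"
  proof (cases k rule: int_cases2)
    case (nonneg n)
    then show ?thesis
      using nat[of n] \<open>k \<noteq> 0\<close> by (simp add: q_def)
  next
    case (nonpos n)
    then show ?thesis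
      using nat[of n] \<open>k \<noteq> 0\<close> quad_even[of ?H, OF even] by (simp add: q_def even)
  qed
qed

subsection \<open>Regularity\<close>

lemma fourier_series_real:
  assumes "\<And>k. A (- k) = cnj (A k)"
  shows "complex_of_real (Re (fourier_series A x)) = fourier_series A x"
proof -
  have "cnj (fourier_series A x) = (\<Sum>\<^sub>\<infinity>k. cnj (A k * cis (of_int k * x)))"
    unfolding fourier_series_def by (rule infsum_cnj[symmetric])
  also have "\<dots> = (\<Sum>\<^sub>\<infinity>k. A (- k) * cis (of_int (- k) * x))"
    by (simp add: assms cis_cnj)
  also have "\<dots> = fourier_series A x"
    unfolding fourier_series_def by (rule infsum_reindex_bij_betw) (rule bij_betwI[where g = uminus], auto)
  finally show ?thesis
    by (metis Reals_cnj_iff of_real_Re)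
qed

lemma fourier_series_periodic: "fourier_series A (x + 2 * pi) = fourier_series A x"
proof -
  have "cis (of_int k * (x + 2 * pi)) = cis (of_int k * x)" for k
    using cos_int_2pin[of k] sin_int_2pin[of k]
    by (simp add: complex_eq_iff distrib_left cos_add sin_add mult_ac)
  then show ?thesis
    by (simp add: fourier_series_def)
qed

lemma norm_cis_diff_le: "norm (cis a - cis b) \<le> \<bar>a - b\<bar>"
proof -
  have "cis a - cis b = cis b * (exp (\<i> * of_real (a - b)) - 1)"
    unfolding cis_conv_exp[symmetric] by (simp add: right_diff_distrib cis_mult)
  then have "norm (cis a - cis b) = 2 * \<bar>sin ((a - b) / 2)\<bar>"
    using dist_exp_i_1[of "a - b"] by (simp add: norm_mult)
  then show ?thesis
    using abs_sin_x_le_abs_x[of "(a - b) / 2"] by simp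
qed

text \<open>Up to distance 1 the Lipschitz bound suffices, beyond it the trivial bound 2, as a
  nonzero \<open>k\<close> has modulus at least 1. A whole power of \<open>k\<close> is spent, so
  the same weight serves every \<alpha>.\<close>

lemma norm_cis_diff_le_powr:
  fixes k :: int and \<alpha> :: real
  assumes "0 < \<alpha>" "\<alpha> < 1"
  shows "norm (cis (of_int k * x) - cis (of_int k * y)) \<le> 2 * \<bar>of_int k\<bar> * \<bar>x - y\<bar> powr \<alpha>"
proof (cases "k = 0 \<or> x = y")
  case False
  then have k: "1 \<le> \<bar>real_of_int k\<bar>" and d: "\<bar>x - y\<bar> > 0"
    by auto
  show ?thesis
  proof (cases "\<bar>x - y\<bar> \<le> 1")
    case True
    have "norm (cis (of_int k * x) - cis (of_int k * y)) \<le> \<bar>of_int k\<bar> * \<bar>x - y\<bar>"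
      using norm_cis_diff_le[of "of_int k * x" "of_int k * y"] by (simp add: abs_mult flip: right_diff_distrib)
    also have "\<dots> \<le> (2 * \<bar>of_int k\<bar>) * \<bar>x - y\<bar> powr \<alpha>"
      using powr_mono'[of \<alpha> 1 "\<bar>x - y\<bar>"] assms True d by (intro mult_mono) auto
    finally show ?thesis .
  next
    case False
    have "norm (cis (of_int k * x) - cis (of_int k * y)) \<le> 2"
      using norm_triangle_ineq4[of "cis (of_int k * x)" "cis (of_int k * y)"] by simp
    also have "\<dots> \<le> 2 * \<bar>of_int k\<bar> * \<bar>x - y\<bar> powr \<alpha>"
      using k ge_one_powr_ge_zero[of "\<bar>x - y\<bar>" \<alpha>] assms False mult_mono[of 1 "\<bar>real_of_int k\<bar>" 1 "\<bar>x - y\<bar> powr \<alpha>"] by simp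
    finally show ?thesis .
  qed
qed auto

text \<open>Boundedness serves the lower bound too: the supremum of an unbounded set of reals is
  unspecified.\<close>

lemma sup_norm_bounds:
  assumes "\<And>x. \<bar>f x\<bar> \<le> c"
  shows "0 \<le> sup_norm f" "sup_norm f \<le> c"
proof -
  have "bdd_above ((\<lambda>x. \<bar>f x\<bar>) ` {0..2 * pi})"
    using assms by (auto intro!: bdd_aboveI)
  then have "\<bar>f 0\<bar> \<le> sup_norm f"
    unfolding sup_norm_def by (intro cSUP_upper) auto
  then show "0 \<le> sup_norm f"
    by linarith
  show "sup_norm f \<le> c"
    unfolding sup_norm_def by (intro cSUP_least) (use assms in auto)
qed

lemma holder_seminorm_bounds:
  assumes "\<And>x y. \<bar>f x - f y\<bar> \<le> c * \<bar>x - y\<bar> powr \<alpha>"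
  shows "0 \<le> holder_seminorm \<alpha> f" "holder_seminorm \<alpha> f \<le> c"
proof -
  let ?S = "{\<bar>f x - f y\<bar> / \<bar>x - y\<bar> powr \<alpha> | x y. x \<in> {0..2 * pi} \<and> y \<in> {0..2 * pi} \<and> x \<noteq> y}"
  have le: "r \<le> c" if "r \<in> ?S" for r
    using that assms by (auto simp: divide_le_eq)
  \<comment> \<open>Both points lie in the period interval since \<open>pi > 3\<close>, and at
    distance 1 the quotient is just the difference.\<close>
  have "\<bar>f 0 - f 1\<bar> / \<bar>0 - 1\<bar> powr \<alpha> \<in> ?S"
    using pi_gt3 by (intro CollectI exI[of _ 0] exI[of _ 1]) auto
  then have mem: "\<bar>f 0 - f 1\<bar> \<in> ?S"
    by simp
  then show "holder_seminorm \<alpha> f \<le> c"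
    unfolding holder_seminorm_def by (intro cSup_least le) blast
  have "bdd_above ?S"
    using le by (rule bdd_aboveI)
  then have "\<bar>f 0 - f 1\<bar> \<le> holder_seminorm \<alpha> f"
    unfolding holder_seminorm_def using mem by (intro cSup_upper)
  then show "0 \<le> holder_seminorm \<alpha> f"
    by linarith
qed

definition derivative_weight_sum :: real where
  "derivative_weight_sum = (\<Sum>\<^sub>\<infinity>k::int. 1 / (1 + \<bar>real_of_int k\<bar>) ^ 2)"

text \<open>Three factors of the frequency lower the weight from power 5 to 2. The unimodular
  \<open>u\<close> stands for the factors \<open>\<i>\<close> and \<open>- 1\<close> of the
  differentiated series.\<close>

lemma derivative_coeffs:
  assumes "dominated C A" "n \<le> 3" "norm u = 1"
  shows "(\<lambda>k. u * of_int k ^ n * complex_of_real (A k)) abs_summable_on UNIV"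
    and "(\<Sum>\<^sub>\<infinity>k. norm (u * of_int k ^ n * complex_of_real (A k))) \<le> C * derivative_weight_sum"
proof -
  have le: "norm (u * of_int k ^ n * complex_of_real (A k)) \<le> C * (1 / (1 + \<bar>real_of_int k\<bar>) ^ 2)" for k
  proof -
    let ?k = "1 + \<bar>real_of_int k\<bar>"
    have "\<bar>real_of_int k\<bar> ^ n \<le> ?k ^ n"
      by (intro power_mono) auto
    also have "\<dots> \<le> ?k ^ 3"
      using assms(2) by (intro power_increasing) auto
    finally have "\<bar>real_of_int k\<bar> ^ n * \<bar>A k\<bar> \<le> ?k ^ 3 * (C / ?k ^ 5)"
      using assms(1) by (intro mult_mono) (auto simp: dominated_def)
    also have "?k ^ 3 * (C / ?k ^ 5) = C * (1 / ?k ^ 2)"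
    proof -
      have "x ^ 3 * (C / x ^ 5) = C * (1 / x ^ 2)" if "x > 0" for x :: real
        using that by (simp add: divide_simps flip: power_add)
      then show ?thesis
        by (simp add: add_pos_nonneg)
    qed
    finally show ?thesis
      using assms(3) by (simp add: norm_mult norm_power)
  qed
  have sum: "(\<lambda>k::int. C * (1 / (1 + \<bar>real_of_int k\<bar>) ^ 2)) summable_on UNIV"
    by (intro summable_on_cmult_right weight_summable) simp
  show abs: "(\<lambda>k. u * of_int k ^ n * complex_of_real (A k)) abs_summable_on UNIV"
    by (rule Infinite_Sum.abs_summable_on_comparison_test'[OF sum]) (rule le)
  show "(\<Sum>\<^sub>\<infinity>k. norm (u * of_int k ^ n * complex_of_real (A k))) \<le> C * derivative_weight_sum"
    using infsum_mono[OF abs sum le] unfolding infsum_cmult_right' derivative_weight_sum_def .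
qed

section \<open>Real profiles and their derivatives\<close>

definition wave :: "(int \<Rightarrow> real) \<Rightarrow> real \<Rightarrow> real" where
  "wave A x = Re (fourier_series (\<lambda>k. complex_of_real (A k)) x)"

definition wave' :: "(int \<Rightarrow> real) \<Rightarrow> real \<Rightarrow> real" where
  "wave' A x = Re (fourier_series (\<lambda>k. \<i> * of_int k * complex_of_real (A k)) x)"

definition wave'' :: "(int \<Rightarrow> real) \<Rightarrow> real \<Rightarrow> real" where
  "wave'' A x = Re (fourier_series (\<lambda>k. - ((of_int k)\<^sup>2) * complex_of_real (A k)) x)"

context
  fixes A :: "int \<Rightarrow> real" and C :: real
  assumes A: "dominated C A"
begin

lemma coeffs_abs_summable: "(\<lambda>k. complex_of_real (A k)) abs_summable_on UNIV"
  using derivative_coeffs(1)[OF A, of 0 1] by simp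

lemma coeffs'_abs_summable: "(\<lambda>k. \<i> * of_int k * complex_of_real (A k)) abs_summable_on UNIV"
  using derivative_coeffs(1)[OF A, of 1 \<i>] by simp

lemma coeffs''_abs_summable: "(\<lambda>k. - ((of_int k)\<^sup>2) * complex_of_real (A k)) abs_summable_on UNIV"
  using derivative_coeffs(1)[OF A, of 2 "-1"] by simp

lemma wave_has_derivative: "(wave A has_real_derivative wave' A x) (at x)"
  using bounded_linear.has_vector_derivative[OF bounded_linear_Re
      fourier_series_has_vector_derivative[OF coeffs_abs_summable], of x]
    derivative_coeffs(1)[OF A, of 1 1]
  by (simp add: has_real_derivative_iff_has_vector_derivative wave_def[abs_def] wave'_def)

lemma wave'_has_derivative: "(wave' A has_real_derivative wave'' A x) (at x)"
proof -
  have eq: "\<i> * of_int k * (\<i> * of_int k * complex_of_real (A k)) = - ((of_int k)\<^sup>2) * complex_of_real (A k)" for k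
    by (simp add: complex_eq_iff power2_eq_square)
  show ?thesis
    using bounded_linear.has_vector_derivative[OF bounded_linear_Re
        fourier_series_has_vector_derivative[OF coeffs'_abs_summable], of x]
      derivative_coeffs(1)[OF A, of 2 1]
    unfolding eq has_real_derivative_iff_has_vector_derivative wave'_def[abs_def] wave''_def
    by (simp add: norm_mult power2_eq_square mult.assoc)
qed

lemma deriv_wave: "deriv (wave A) = wave' A"
  using wave_has_derivative by (auto intro: DERIV_imp_deriv)

lemma deriv_wave': "deriv (wave' A) = wave'' A"
  using wave'_has_derivative by (auto intro: DERIV_imp_deriv)

lemma continuous_on_wave'': "continuous_on S (wave'' A)"
  unfolding wave''_def[abs_def] by (intro continuous_intros fourier_series_continuous coeffs''_abs_summable)

lemma wave_le: "\<bar>wave A x\<bar> \<le> C * derivative_weight_sum"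
  using norm_fourier_series_le[OF coeffs_abs_summable, of x] derivative_coeffs(2)[OF A, of 0 1]
    abs_Re_le_cmod[of "fourier_series (\<lambda>k. complex_of_real (A k)) x"]
  by (simp add: wave_def)

lemma wave'_le: "\<bar>wave' A x\<bar> \<le> C * derivative_weight_sum"
  using norm_fourier_series_le[OF coeffs'_abs_summable, of x] derivative_coeffs(2)[OF A, of 1 \<i>]
    abs_Re_le_cmod[of "fourier_series (\<lambda>k. \<i> * of_int k * complex_of_real (A k)) x"]
  by (simp add: wave'_def)

lemma wave''_le: "\<bar>wave'' A x\<bar> \<le> C * derivative_weight_sum"
  using norm_fourier_series_le[OF coeffs''_abs_summable, of x] derivative_coeffs(2)[OF A, of 2 "-1"]
    abs_Re_le_cmod[of "fourier_series (\<lambda>k. - ((of_int k)\<^sup>2) * complex_of_real (A k)) x"]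
  by (simp add: wave''_def)

text \<open>Two factors of the frequency come from differentiation and a third from
  \<open>norm_cis_diff_le_powr\<close>, hence the cube.\<close>

lemma wave''_holder:
  assumes "0 < \<alpha>" "\<alpha> < 1"
  shows "\<bar>wave'' A x - wave'' A y\<bar> \<le> 2 * C * derivative_weight_sum * \<bar>x - y\<bar> powr \<alpha>"
proof -
  let ?B = "\<lambda>k. - ((of_int k)\<^sup>2) * complex_of_real (A k)"
  let ?t = "\<lambda>k. ?B k * cis (of_int k * x) - ?B k * cis (of_int k * y)"
  let ?d = "2 * \<bar>x - y\<bar> powr \<alpha>"
  let ?u = "\<lambda>k. norm (1 * of_int k ^ 3 * complex_of_real (A k))"
  note cube = derivative_coeffs[OF A, of 3 1, simplified]
  have sum: "(?t has_sum (fourier_series ?B x - fourier_series ?B y)) UNIV"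
    using has_sum_add[OF fourier_series_has_sum[OF coeffs''_abs_summable, of x]
        has_sum_uminusI[OF fourier_series_has_sum[OF coeffs''_abs_summable, of y]]]
    by simp
  have le: "norm (?t k) \<le> ?d * ?u k" for k
  proof -
    have "norm (?t k) = \<bar>of_int k\<bar>\<^sup>2 * \<bar>A k\<bar> * norm (cis (of_int k * x) - cis (of_int k * y))"
      unfolding right_diff_distrib[symmetric] by (simp add: norm_mult norm_power)
    also have "\<dots> \<le> \<bar>of_int k\<bar>\<^sup>2 * \<bar>A k\<bar> * (2 * \<bar>of_int k\<bar> * \<bar>x - y\<bar> powr \<alpha>)"
      by (intro mult_left_mono norm_cis_diff_le_powr assms) auto
    also have "\<dots> = ?d * ?u k"
      by (simp add: norm_mult norm_power eval_nat_numeral)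
    finally show ?thesis .
  qed
  have "norm (fourier_series ?B x - fourier_series ?B y) \<le> (\<Sum>\<^sub>\<infinity>k. ?d * ?u k)"
    by (rule norm_infsum_le[OF sum has_sum_infsum[OF summable_on_cmult_right] le])
      (use cube in simp)
  also have "\<dots> \<le> ?d * (C * derivative_weight_sum)"
    unfolding infsum_cmult_right' using cube by (intro mult_left_mono) auto
  finally show ?thesis
    using abs_Re_le_cmod[of "fourier_series ?B x - fourier_series ?B y"] by (simp add: wave''_def mult_ac)
qed

lemma wave_C2_holder:
  assumes "0 < \<alpha>" "\<alpha> < 1"
  shows "wave A \<in> C2_holder \<alpha>"
  unfolding C2_holder_def deriv_wave deriv_wave' mem_Collect_eq
proof (intro conjI allI)
  show "wave A differentiable at x" "wave' A differentiable at x" for x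
    using wave_has_derivative wave'_has_derivative by (auto simp: real_differentiable_def)
  show "\<exists>K. \<forall>x y. \<bar>wave'' A x - wave'' A y\<bar> \<le> K * \<bar>x - y\<bar> powr \<alpha>"
    using wave''_holder[OF assms] by blast
qed

text \<open>The 5 counts three supremum norms and the Hoelder constant 2.\<close>

lemma wave_C2_holder_norm:
  assumes "0 < \<alpha>" "\<alpha> < 1"
  shows "0 \<le> C2_holder_norm \<alpha> (wave A)" "C2_holder_norm \<alpha> (wave A) \<le> 5 * C * derivative_weight_sum"
  using sup_norm_bounds[of "wave A", OF wave_le] sup_norm_bounds[of "wave' A", OF wave'_le]
    sup_norm_bounds[of "wave'' A", OF wave''_le]
    holder_seminorm_bounds[of "wave'' A", OF wave''_holder[OF assms]]
  by (simp_all add: C2_holder_norm_def deriv_wave deriv_wave')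

text \<open>Evenness pairs \<open>k\<close> with \<open>- k\<close>, which gives cosines with the
  factor 2; only nonzero multiples of \<open>m\<close> contribute.\<close>

lemma wave_sums:
  assumes "1 \<le> m" and even: "\<And>k. A (- k) = A k" and "A 0 = 0"
    and supp: "\<And>k. \<not> int m dvd k \<Longrightarrow> A k = 0"
  shows "(\<lambda>n. 2 * A (int (m * Suc n)) * cos (real m * real (Suc n) * x)) sums wave A x"
proof -
  let ?f = "\<lambda>k. A k * cos (of_int k * x)"
  have "(?f has_sum wave A x) UNIV"
    using has_sum_Re[OF fourier_series_has_sum[OF coeffs_abs_summable, of x]] by (simp add: wave_def)
  also have "?this \<longleftrightarrow> (?f has_sum wave A x) (range (\<lambda>n. int (m * Suc n)) \<union> range (\<lambda>n. - int (m * Suc n)))"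
  proof (rule has_sum_cong_neutral)
    fix k assume k: "k \<in> UNIV - (range (\<lambda>n. int (m * Suc n)) \<union> range (\<lambda>n. - int (m * Suc n)))"
    have "A k = 0"
    proof (rule ccontr)
      assume "A k \<noteq> 0"
      then have "int m dvd k" "k \<noteq> 0"
        using supp \<open>A 0 = 0\<close> by auto
      then obtain j where j: "k = int m * j" "j \<noteq> 0"
        by auto
      \<comment> \<open>Subtracting 1 undoes the \<open>Suc\<close> in the index; it does not
        truncate, as \<open>j \<noteq> 0\<close>.\<close>
      then have "k = int (m * Suc (nat \<bar>j\<bar> - 1)) \<or> k = - int (m * Suc (nat \<bar>j\<bar> - 1))"
        by (cases "j > 0") (auto simp: algebra_simps)
      then show False
        using k by blast
    qed
    then show "?f k = 0" by simp
  qed auto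
  finally have sum: "(?f has_sum wave A x) (range (\<lambda>n. int (m * Suc n)) \<union> range (\<lambda>n. - int (m * Suc n)))" .
  have summ: "?f summable_on S" for S
    using \<open>(?f has_sum wave A x) UNIV\<close> summable_on_subset_banach by (metis has_sum_imp_summable subset_UNIV)
  let ?P = "infsum ?f (range (\<lambda>n. int (m * Suc n)))"
  have inj: "inj (\<lambda>n. int (m * Suc n))" "inj (\<lambda>n. - int (m * Suc n))"
    using assms(1) by (auto simp: inj_on_def)
  have P: "((\<lambda>n. ?f (int (m * Suc n))) has_sum ?P) UNIV"
    using has_sum_infsum[OF summ[of "range (\<lambda>n. int (m * Suc n))"]]
    by (subst (asm) has_sum_reindex[OF inj(1)]) (simp add: o_def)
  have "((\<lambda>n. ?f (- int (m * Suc n))) has_sum ?P) UNIV"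
    using P by (simp only: even of_int_minus mult_minus_left cos_minus)
  then have N: "(?f has_sum ?P) (range (\<lambda>n. - int (m * Suc n)))"
    by (subst has_sum_reindex[OF inj(2)]) (simp add: o_def)
  have "range (\<lambda>n. int (m * Suc n)) \<inter> range (\<lambda>n. - int (m * Suc n)) = {}"
  proof -
    have "0 < int (m * Suc n)" for n
      using assms(1) by (simp only: of_nat_0_less_iff) simp
    then show ?thesis
      by (smt (verit) disjoint_iff rangeE)
  qed
  then have "wave A x = ?P + ?P"
    using has_sum_unique[OF sum has_sum_Un_disjoint[OF has_sum_infsum[OF summ] N]] by blast
  then have "((\<lambda>n. 2 * ?f (int (m * Suc n))) has_sum wave A x) UNIV"
    using has_sum_cmult_right[OF P, of 2] by simp
  moreover have "real_of_int (int (m * Suc n)) = real m * real (Suc n)" for n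
    by (simp add: algebra_simps)
  ultimately show ?thesis
    by (intro has_sum_imp_sums) (simp only: mult.assoc)
qed

end

lemma wave_diff:
  assumes "dominated C A" "dominated D B"
  shows "wave A x - wave B x = wave (\<lambda>k. A k - B k) x"
  using fourier_series_diff[OF coeffs_abs_summable[OF assms(1)] coeffs_abs_summable[OF assms(2)], of x]
  by (simp add: wave_def)

subsection \<open>Travelling waves\<close>

abbreviation symbolQ :: "int \<Rightarrow> complex" where
  "symbolQ k \<equiv> 1 / (1 + (of_int k)\<^sup>2)"

abbreviation symbolN :: "int \<Rightarrow> complex" where
  "symbolN k \<equiv> \<i> * of_int k / (1 + (of_int k)\<^sup>2)"

lemma one_plus_square_int: "(1 + (of_int k)\<^sup>2 :: complex) = of_real (1 + (real_of_int k)\<^sup>2)"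
  by simp

lemma one_plus_square_int_neq_0: "(1 + (of_int k)\<^sup>2 :: complex) \<noteq> 0"
proof -
  have "1 + (real_of_int k)\<^sup>2 > 0"
    by (intro add_pos_nonneg) auto
  then show ?thesis
    unfolding one_plus_square_int of_real_eq_0_iff by linarith
qed

lemma norm_symbols_le: "norm (symbolQ k) \<le> 1" "norm (symbolN k) \<le> 1"
proof -
  have pos: "1 + (real_of_int k)\<^sup>2 > 0"
    by (intro add_pos_nonneg) auto
  have norm: "norm (1 + (of_int k)\<^sup>2 :: complex) = 1 + (real_of_int k)\<^sup>2"
    unfolding one_plus_square_int norm_of_real using pos by simp
  show "norm (symbolQ k) \<le> 1"
    using pos by (simp add: norm_divide norm)
  have "2 * \<bar>real_of_int k\<bar> \<le> 1 + (real_of_int k)\<^sup>2"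
    using zero_le_power2[of "\<bar>real_of_int k\<bar> - 1"] by (simp add: power2_eq_square algebra_simps)
  then show "norm (symbolN k) \<le> 1"
    using pos by (simp add: norm_divide norm_mult norm)
qed

lemma symbol_mult_abs_summable:
  assumes "B abs_summable_on UNIV" and "\<And>k. norm (\<mu> k) \<le> 1"
  shows "(\<lambda>k::int. \<mu> k * (B k :: complex)) abs_summable_on UNIV"
  by (rule Infinite_Sum.abs_summable_on_comparison_test'[OF assms(1)])
    (use assms(2) in \<open>simp add: norm_mult mult_left_le_one_le\<close>)

lemma convolution_has_sum:
  assumes "B abs_summable_on UNIV" "B' abs_summable_on UNIV"
  shows "((\<lambda>j. B j * B' (k - j)) has_sum convolution B B' k) UNIV"
  unfolding convolution_def
  by (rule has_sum_infsum[OF abs_summable_summable[OF convolution_summand_abs_summable[OF assms]]])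

text \<open>
  The two nonlinear terms combine, after symmetrisation in the two frequencies, into the kernel
  \<open>interaction\<close>.
\<close>

lemma interaction_identity:
  fixes x y p q :: complex
  assumes "1 + x\<^sup>2 \<noteq> 0" "1 + y\<^sup>2 \<noteq> 0"
  shows "\<i> * (x + y) * (p * q)
      - ((- (x\<^sup>2) * p * (\<i> * y / (1 + y\<^sup>2) * q) - p * (\<i> * y / (1 + y\<^sup>2) * (- (y\<^sup>2) * q)))
       + (- (y\<^sup>2) * q * (\<i> * x / (1 + x\<^sup>2) * p) - q * (\<i> * x / (1 + x\<^sup>2) * (- (x\<^sup>2) * p))))
    = \<i> * (x + y) * (p * q * (1 - (x - y)\<^sup>2 * (1 - x * y) / ((1 + x\<^sup>2) * (1 + y\<^sup>2))))"
proof -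
  \<comment> \<open>The symbols of \<open>opN\<close> enter only through this difference. Its factor
    \<open>y - x\<close> and the \<open>(x + y) * (y - x)\<close> from the second derivatives
    produce the square in the kernel.\<close>
  have "y / (1 + y\<^sup>2) - x / (1 + x\<^sup>2) = (y - x) * (1 - x * y) / ((1 + x\<^sup>2) * (1 + y\<^sup>2))"
    using assms by (simp add: divide_simps) algebra
  then have "\<i> * (x + y) * (p * q * (1 - (x - y)\<^sup>2 * (1 - x * y) / ((1 + x\<^sup>2) * (1 + y\<^sup>2))))
    = \<i> * (x + y) * (p * q) - \<i> * p * q * ((x + y) * (y - x)) * (y / (1 + y\<^sup>2) - x / (1 + x\<^sup>2))"
    by (simp add: power2_eq_square algebra_simps)
  then show ?thesis
    by (simp add: power2_eq_square algebra_simps)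
qed

text \<open>The summands and their reflections under \<open>k - j\<close> have the same sum, so
  \<open>2 * ?D\<close> is a sum of symmetrised terms, to which \<open>interaction_identity\<close>
  applies. The factor \<open>k\<close> on both sides lets \<open>k = 0\<close> be included.\<close>

lemma nonlinear_coeff:
  fixes A :: "int \<Rightarrow> real" and k :: int
  defines "a \<equiv> \<lambda>k. complex_of_real (A k)"
  defines "b \<equiv> \<lambda>k. - ((of_int k)\<^sup>2) * complex_of_real (A k)"
  assumes A: "dominated C A"
  shows "\<i> * of_int k * convolution a a k
      - 2 * (convolution b (\<lambda>k. symbolN k * a k) k - convolution a (\<lambda>k. symbolN k * b k) k)
    = \<i> * of_int k * complex_of_real (2 * quad A A k)" (is "_ - 2 * ?D = _")
proof -
  have a: "a abs_summable_on UNIV" and b: "b abs_summable_on UNIV"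
    unfolding a_def b_def by (rule coeffs_abs_summable[OF A], rule coeffs''_abs_summable[OF A])
  note Na = symbol_mult_abs_summable[where \<mu> = symbolN, OF a norm_symbols_le(2)]
    and Nb = symbol_mult_abs_summable[where \<mu> = symbolN, OF b norm_symbols_le(2)]
  let ?t = "\<lambda>j. b j * (symbolN (k - j) * a (k - j)) - a j * (symbolN (k - j) * b (k - j))"
  have t: "(?t has_sum ?D) UNIV"
    using has_sum_add[OF convolution_has_sum[OF b Na, of k] has_sum_uminusI[OF convolution_has_sum[OF a Nb, of k]]]
    by simp
  have "bij_betw (\<lambda>j. k - j) UNIV (UNIV :: int set)"
    by (rule bij_betwI[where g = "\<lambda>j. k - j"]) auto
  from t have t': "((\<lambda>j. ?t (k - j)) has_sum ?D) UNIV"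
    unfolding has_sum_reindex_bij_betw[OF \<open>bij_betw _ _ _\<close>, of ?t] .
  have "((\<lambda>j. \<i> * of_int k * (a j * a (k - j)) - (?t j + ?t (k - j))) has_sum
      (\<i> * of_int k * convolution a a k - 2 * ?D)) UNIV"
    using has_sum_add[OF has_sum_cmult_right[OF convolution_has_sum[OF a a, of k], of "\<i> * of_int k"]
        has_sum_uminusI[OF has_sum_add[OF t t']]]
    by (simp only: diff_conv_add_uminus mult_2)
  moreover have "\<i> * of_int k * (a j * a (k - j)) - (?t j + ?t (k - j))
      = \<i> * of_int k * complex_of_real (A j * A (k - j) * interaction j (k - j))" for j
  proof -
    have k: "of_int k = (of_int j + of_int (k - j) :: complex)"
      by simp
    show ?thesis
      using interaction_identity[OF one_plus_square_int_neq_0 one_plus_square_int_neq_0, of j "k - j" "a j" "a (k - j)"]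
      unfolding k[symmetric] a_def b_def interaction_def by simp
  qed
  ultimately have 1: "((\<lambda>j. \<i> * of_int k * complex_of_real (A j * A (k - j) * interaction j (k - j))) has_sum
      (\<i> * of_int k * convolution a a k - 2 * ?D)) UNIV"
    by simp
  have "((\<lambda>j. A j * A (k - j) * interaction j (k - j)) has_sum 2 * quad A A k) UNIV"
    using has_sum_infsum[OF abs_summable_summable[OF quad_summand_abs_summable[OF A A, of k]]]
    by (simp add: quad_def)
  then have "((\<lambda>j. \<i> * of_int k * complex_of_real (A j * A (k - j) * interaction j (k - j))) has_sum
      \<i> * of_int k * complex_of_real (2 * quad A A k)) UNIV"
    by (intro has_sum_cmult_right has_sum_of_real)
  with 1 show ?thesis
    by (rule has_sum_unique)
qed

lemma of_real_wave:
  assumes "\<And>k. A (- k) = A k"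
  shows "complex_of_real (wave A x) = fourier_series (\<lambda>k. complex_of_real (A k)) x"
  unfolding wave_def by (rule fourier_series_real) (simp add: assms)

text \<open>In the moving frame every term is an absolutely convergent Fourier series at
  \<open>z - c * t\<close>, so it suffices that the coefficients agree.\<close>

lemma wave_solves_equation:
  assumes A: "dominated C A" and even: "\<And>k. A (- k) = A k"
    and eq: "\<And>k. k \<noteq> 0 \<Longrightarrow> (c * (1 + (real_of_int k)\<^sup>2) - 2) * A k = 2 * quad A A k"
  shows "solves_equation (\<lambda>z t. wave A (z - c * t))"
proof -
  define a where "a = (\<lambda>k. complex_of_real (A k))"
  define a' where "a' = (\<lambda>k. \<i> * of_int k * complex_of_real (A k))"
  define b where "b = (\<lambda>k. - ((of_int k)\<^sup>2) * complex_of_real (A k))"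
  have a: "a abs_summable_on UNIV" and b: "b abs_summable_on UNIV" and a': "a' abs_summable_on UNIV"
    unfolding a_def b_def a'_def
    by (rule coeffs_abs_summable[OF A], rule coeffs''_abs_summable[OF A], rule coeffs'_abs_summable[OF A])
  note Na = symbol_mult_abs_summable[where \<mu> = symbolN, OF a norm_symbols_le(2)]
    and Nb = symbol_mult_abs_summable[where \<mu> = symbolN, OF b norm_symbols_le(2)]
  have wave: "complex_of_real (wave A x) = fourier_series a x" for x
    unfolding a_def by (rule of_real_wave) (rule even)
  have wave': "complex_of_real (wave' A x) = fourier_series a' x" for x
    unfolding wave'_def a'_def by (rule fourier_series_real) (simp add: even)
  have wave'': "complex_of_real (wave'' A x) = fourier_series b x" for x
    unfolding wave''_def b_def by (rule fourier_series_real) (simp add: even)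
  define d where "d = (\<lambda>k. convolution b (\<lambda>k. symbolN k * a k) k - convolution a (\<lambda>k. symbolN k * b k) k)"
  note conv_aa = convolution_abs_summable[OF a a]
    and conv_bNa = convolution_abs_summable[OF b Na]
    and conv_aNb = convolution_abs_summable[OF a Nb]
  have d: "d abs_summable_on UNIV"
  proof (rule Infinite_Sum.abs_summable_on_comparison_test')
    show "(\<lambda>k. norm (convolution b (\<lambda>k. symbolN k * a k) k) + norm (convolution a (\<lambda>k. symbolN k * b k) k))
        summable_on UNIV"
      by (intro summable_on_add conv_bNa conv_aNb)
  qed (auto simp: d_def intro: norm_triangle_ineq4)
  have opN_wave: "complex_of_real (opN (\<lambda>y. wave A (y - \<sigma>)) z) = fourier_series (\<lambda>k. symbolN k * a k) (z - \<sigma>)" for \<sigma> z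
    unfolding of_real_opN by (rule fourier_multiplier_fourier_series[OF a wave])
  have opN_wave'': "complex_of_real (opN (\<lambda>y. wave'' A (y - \<sigma>)) z) = fourier_series (\<lambda>k. symbolN k * b k) (z - \<sigma>)" for \<sigma> z
    unfolding of_real_opN by (rule fourier_multiplier_fourier_series[OF b wave''])
  have opN_square: "complex_of_real (opN (\<lambda>y. (wave A (y - \<sigma>))\<^sup>2) z)
      = fourier_series (\<lambda>k. symbolN k * convolution a a k) (z - \<sigma>)" for \<sigma> z
    unfolding of_real_opN
    by (rule fourier_multiplier_fourier_series[OF conv_aa])
      (simp add: power2_eq_square wave fourier_series_mult[OF a a])
  have opQ_term: "complex_of_real (opQ (\<lambda>y. wave'' A (y - \<sigma>) * opN (\<lambda>x. wave A (x - \<sigma>)) y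
        - wave A (y - \<sigma>) * opN (\<lambda>x. wave'' A (x - \<sigma>)) y) z)
      = fourier_series (\<lambda>k. symbolQ k * d k) (z - \<sigma>)" for \<sigma> z
    unfolding of_real_opQ
  proof (rule fourier_multiplier_fourier_series[OF d])
    fix y
    show "complex_of_real (wave'' A (y - \<sigma>) * opN (\<lambda>x. wave A (x - \<sigma>)) y
        - wave A (y - \<sigma>) * opN (\<lambda>x. wave'' A (x - \<sigma>)) y) = fourier_series d (y - \<sigma>)"
      unfolding of_real_diff of_real_mult wave wave'' opN_wave opN_wave''
        fourier_series_mult[OF b Na] fourier_series_mult[OF a Nb] d_def
      by (rule fourier_series_diff[OF conv_bNa conv_aNb, symmetric])
  qed
  note conv = symbol_mult_abs_summable[where \<mu> = symbolN, OF conv_aa norm_symbols_le(2)]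
    and Qd = symbol_mult_abs_summable[where \<mu> = symbolQ, OF d norm_symbols_le(1)]
  have coeff: "- complex_of_real c * a' k + 2 * (symbolN k * a k)
      = - 1 * (symbolN k * convolution a a k) + 2 * (symbolQ k * d k)" for k
  proof -
    define P :: complex where "P = 1 + (of_int k)\<^sup>2"
    have P: "P \<noteq> 0"
      unfolding P_def by (rule one_plus_square_int_neq_0)
    have nl: "\<i> * of_int k * convolution a a k - 2 * d k = \<i> * of_int k * complex_of_real (2 * quad A A k)"
      unfolding d_def a_def b_def by (rule nonlinear_coeff[OF A])
    \<comment> \<open>At \<open>k = 0\<close> both sides vanish; \<open>eq\<close> supplies the
      other frequencies.\<close>
    have "\<i> * of_int k * complex_of_real ((c * (1 + (real_of_int k)\<^sup>2) - 2) * A k)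
        = \<i> * of_int k * complex_of_real (2 * quad A A k)"
      using eq[of k] by (cases "k = 0") auto
    then have "\<i> * of_int k * ((of_real c * P - 2) * a k) = \<i> * of_int k * convolution a a k - 2 * d k"
      unfolding nl by (simp add: a_def P_def)
    then have "(of_real c * P - 2) * (\<i> * of_int k * a k) / P = (\<i> * of_int k * convolution a a k - 2 * d k) / P"
      by (simp add: mult.left_commute)
    moreover have "(of_real c * P - 2) * (\<i> * of_int k * a k) / P = of_real c * a' k - 2 * (\<i> * of_int k / P * a k)"
      using P by (simp add: a'_def a_def field_simps)
    ultimately have "of_real c * a' k - 2 * (\<i> * of_int k / P * a k)
        = \<i> * of_int k / P * convolution a a k - 2 * (1 / P * d k)"
      by (simp add: diff_divide_distrib)
    then show ?thesis
      unfolding P_def by (simp add: algebra_simps)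
  qed
  have scale: "(\<lambda>k. u * B k) abs_summable_on UNIV" if "B abs_summable_on UNIV" for u :: complex and B :: "int \<Rightarrow> complex"
    using that by (simp add: norm_mult summable_on_cmult_right)
  have "fourier_series (\<lambda>k. - complex_of_real c * a' k + 2 * (symbolN k * a k)) x
      = fourier_series (\<lambda>k. - 1 * (symbolN k * convolution a a k) + 2 * (symbolQ k * d k)) x" for x
    unfolding coeff ..
  then have series: "- complex_of_real c * fourier_series a' x + 2 * fourier_series (\<lambda>k. symbolN k * a k) x
      = - 1 * fourier_series (\<lambda>k. symbolN k * convolution a a k) x + 2 * fourier_series (\<lambda>k. symbolQ k * d k) x" for x
    unfolding fourier_series_add[OF scale[OF a'] scale[OF Na]] fourier_series_add[OF scale[OF conv] scale[OF Qd]]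
      fourier_series_cmult .
  have key: "- c * wave' A (z - c * t) + 2 * opN (\<lambda>y. wave A (y - c * t)) z =
      - opN (\<lambda>y. (wave A (y - c * t))\<^sup>2) z
      + 2 * opQ (\<lambda>y. wave'' A (y - c * t) * opN (\<lambda>x. wave A (x - c * t)) y
          - wave A (y - c * t) * opN (\<lambda>x. wave'' A (x - c * t)) y) z" for z t
  proof -
    have "complex_of_real (- c * wave' A (z - c * t) + 2 * opN (\<lambda>y. wave A (y - c * t)) z) =
      complex_of_real (- opN (\<lambda>y. (wave A (y - c * t))\<^sup>2) z
      + 2 * opQ (\<lambda>y. wave'' A (y - c * t) * opN (\<lambda>x. wave A (x - c * t)) y
          - wave A (y - c * t) * opN (\<lambda>x. wave'' A (x - c * t)) y) z)"
      using series[of "z - c * t"]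
      by (simp only: of_real_add of_real_mult of_real_minus of_real_numeral opN_wave opN_square opQ_term wave'
          mult_minus1)
    then show ?thesis
      by (simp only: of_real_eq_iff)
  qed
  show ?thesis
    unfolding solves_equation_def
  proof (intro conjI allI exI)
    show "wave A (z + 2 * pi - c * t) = wave A (z - c * t)" for z t
      using fourier_series_periodic[of _ "z - c * t"] by (simp add: wave_def algebra_simps)
    show "((\<lambda>\<tau>. wave A (z - c * \<tau>)) has_real_derivative - c * wave' A (z - c * t)) (at t)" for z t
      by (rule DERIV_cong[OF DERIV_chain2[OF wave_has_derivative[OF A]]]) (auto intro!: derivative_eq_intros)
    show "((\<lambda>y. wave A (y - c * t)) has_real_derivative wave' A (z - c * t)) (at z)" for z t
      by (rule DERIV_cong[OF DERIV_chain2[OF wave_has_derivative[OF A]]]) (auto intro!: derivative_eq_intros)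
    show "((\<lambda>y. wave' A (y - c * t)) has_real_derivative wave'' A (z - c * t)) (at z)" for z t
      by (rule DERIV_cong[OF DERIV_chain2[OF wave'_has_derivative[OF A]]]) (auto intro!: derivative_eq_intros)
    show "continuous_on UNIV (\<lambda>y. wave'' A (y - c * t))" for t
      by (intro continuous_on_compose2[OF continuous_on_wave''[OF A, of UNIV]] continuous_intros) auto
  qed (rule key)
qed

section \<open>The curve of travelling waves\<close>

theorem theorem2:
  fixes \<alpha> :: real and m :: nat
  assumes "0 < \<alpha>" and "\<alpha> < 1" and "m \<ge> 1"
  shows "\<exists>(I :: real set) (c :: real \<Rightarrow> real) (\<phi> :: real \<Rightarrow> real \<Rightarrow> real).
           is_interval I \<and> (\<exists>a\<in>I. \<exists>b\<in>I. a < b) \<and>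
           (\<forall>s\<in>I. \<phi> s \<in> X_space \<alpha> m) \<and>
           continuous_curve \<alpha> I c \<phi> \<and>
           inj_on (\<lambda>s. (c s, \<phi> s)) I \<and>
           (\<forall>s\<in>I. \<phi> s \<noteq> (\<lambda>_. 0) \<and> solves_equation (\<lambda>z t. \<phi> s (z - c s * t)))"
proof -
  define K where "K = (2 + (real m)\<^sup>2) * (32 * weight_sum * (1 + real m) ^ 10)"
  have "0 \<le> K"
    unfolding K_def using weight_sum_nonneg by (intro mult_nonneg_nonneg) auto
  have "\<exists>\<epsilon>>0. \<exists>X. \<forall>s\<in>{0<..\<epsilon>}.
      (\<forall>j. \<bar>X s j\<bar> \<le> 1 \<and> X s j = s * profile_map m (X s) j) \<and>
      (\<forall>t\<in>{0<..\<epsilon>}. \<forall>j. \<bar>X s j - X t j\<bar> \<le> 2 * K * \<bar>s - t\<bar>)"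
    unfolding K_def using assms(3)
    by (intro small_parameter_fixed_points[OF profile_map_le profile_map_diff_le])
  then obtain \<epsilon> X where "\<epsilon> > 0" and X: "\<forall>s\<in>{0<..\<epsilon>}.
      (\<forall>j. \<bar>X s j\<bar> \<le> 1 \<and> X s j = s * profile_map m (X s) j) \<and>
      (\<forall>t\<in>{0<..\<epsilon>}. \<forall>j. \<bar>X s j - X t j\<bar> \<le> 2 * K * \<bar>s - t\<bar>)"
    by blast
  \<comment> \<open>The left end is open: the amplitude \<open>s / 2\<close> would give the zero
    wave there.\<close>
  define I where "I = {0<..\<epsilon>}"
  have X_le: "\<bar>X s j\<bar> \<le> 1" and X_eq: "X s j = s * profile_map m (X s) j" if "s \<in> I" for s j
    using X that unfolding I_def by blast+
  have X_diff: "\<bar>X s j - X t j\<bar> \<le> 2 * K * \<bar>s - t\<bar>" if "s \<in> I" "t \<in> I" for s t j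
    using X that unfolding I_def by blast
  define A where "A s k = s / 2 * modes m (X s) k" for s k
  \<comment> \<open>Solves \<open>x m = c * (1 + m\<^sup>2) - 2\<close>, the encoding of the speed,
    for \<open>c\<close>.\<close>
  define c where "c s = (2 + X s m) / (1 + (real m)\<^sup>2)" for s
  define M where "M = (1 + real m) ^ 5"
  have H: "dominated M (modes m (X s))" if "s \<in> I" for s
    unfolding M_def by (rule modes_dominated) (rule X_le[OF that])
  have A: "dominated (\<bar>s / 2\<bar> * M) (A s)" if "s \<in> I" for s
    unfolding A_def[abs_def] by (rule dominated_cmult[OF H[OF that]])
  \<comment> \<open>The first part is the change of amplitude, the second the change of shape at
    fixed amplitude.\<close>
  have A_diff: "dominated (\<bar>(t - s) / 2\<bar> * M + \<bar>s / 2\<bar> * (2 * K * \<bar>t - s\<bar>)) (\<lambda>k. A t k - A s k)"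
    if "s \<in> I" "t \<in> I" for s t
  proof -
    have "(\<lambda>k. A t k - A s k) =
        (\<lambda>k. (t - s) / 2 * modes m (X t) k + s / 2 * (modes m (X t) k - modes m (X s) k))"
      by (auto simp: A_def field_simps)
    then show ?thesis
      using that by (simp only:) (intro dominated_add dominated_cmult H modes_diff_dominated X_diff)
  qed
  have even: "A s (- k) = A s k" for s k
    by (simp add: A_def modes_def)
  have profile: "(c s * (1 + (real_of_int k)\<^sup>2) - 2) * A s k = 2 * quad (A s) (A s) k"
    if "s \<in> I" "k \<noteq> 0" for s k
  proof -
    have "(c s * (1 + (real_of_int k)\<^sup>2) - 2) * modes m (X s) k = s * quad (modes m (X s)) (modes m (X s)) k"
      unfolding c_def by (rule profile_equation(1)[OF assms(3) X_eq[OF that(1)] that(2)])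
    then have "s / 2 * ((c s * (1 + (real_of_int k)\<^sup>2) - 2) * modes m (X s) k)
        = s / 2 * (s * quad (modes m (X s)) (modes m (X s)) k)"
      by (simp only:)
    then show ?thesis
      unfolding A_def[abs_def] quad_cmult by (simp add: power2_eq_square mult_ac)
  qed
  have supp: "A s k = 0" if "s \<in> I" "\<not> int m dvd k" for s k
    using profile_equation(2)[OF assms(3) X_eq[OF that(1)] _ that(2)] that(2) by (cases "k = 0") (auto simp: A_def)
  have zero: "A s 0 = 0" if "s \<in> I" for s
    using profile_equation(3)[OF assms(3) X_eq[OF that], of 1] by (simp add: A_def)
  \<comment> \<open>The parameter can be read off the profile; injectivity and nontriviality both
    follow from this.\<close>
  have coeff: "fourier_coeff (wave (A s)) (int m) = complex_of_real (s / 2)" if "s \<in> I" for s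
  proof -
    have "complex_of_real (wave (A s) x) = fourier_series (\<lambda>k. complex_of_real (A s k)) x" for x
      by (rule of_real_wave) (rule even)
    then show ?thesis
      using fourier_coeff_fourier_series[OF coeffs_abs_summable[OF A[OF that]], of "wave (A s)" "int m"]
      by (simp add: A_def modes_def)
  qed
  have "wave (A s) \<in> X_space \<alpha> m" if "s \<in> I" for s
    unfolding X_space_def mem_Collect_eq
  proof (intro conjI exI allI)
    show "wave (A s) \<in> C2_holder \<alpha>"
      by (rule wave_C2_holder[OF A[OF that] assms(1,2)])
    show "(\<lambda>k. 2 * A s (int (m * Suc k)) * cos (real m * real (Suc k) * \<xi>)) sums wave (A s) \<xi>" for \<xi>
      by (rule wave_sums[OF A[OF that] assms(3) even zero[OF that] supp[OF that]])
  qed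
  moreover have "continuous_curve \<alpha> I c (\<lambda>s. wave (A s))"
    unfolding continuous_curve_def
  proof (intro conjI ballI)
    have "(2 * K)-lipschitz_on I (\<lambda>s. X s m)"
      using X_diff \<open>0 \<le> K\<close> by (intro lipschitz_onI) (auto simp: dist_real_def)
    then have "continuous_on I (\<lambda>s. X s m)"
      by (rule lipschitz_on_continuous_on)
    then show "continuous_on I c"
      unfolding c_def[abs_def] divide_inverse by (intro continuous_intros)
    fix s assume s: "s \<in> I"
    \<comment> \<open>The constant of \<open>A_diff\<close>. It vanishes at \<open>t = s\<close>,
      and a multiple of it bounds the norm of the difference.\<close>
    let ?C = "\<lambda>t. \<bar>(t - s) / 2\<bar> * M + \<bar>s / 2\<bar> * (2 * K * \<bar>t - s\<bar>)"
    show "((\<lambda>t. C2_holder_norm \<alpha> (\<lambda>x. wave (A t) x - wave (A s) x)) \<longlongrightarrow> 0) (at s within I)"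
    proof (rule tendsto_sandwich)
      have I: "eventually (\<lambda>t. t \<in> I) (at s within I)"
        by (auto simp: eventually_at_filter)
      have diff: "(\<lambda>x. wave (A t) x - wave (A s) x) = wave (\<lambda>k. A t k - A s k)" if "t \<in> I" for t
        using wave_diff[OF A[OF that] A[OF s]] by auto
      show "\<forall>\<^sub>F t in at s within I. 0 \<le> C2_holder_norm \<alpha> (\<lambda>x. wave (A t) x - wave (A s) x)"
        using I by eventually_elim (simp only: diff wave_C2_holder_norm(1)[OF A_diff[OF s] assms(1,2)])
      show "\<forall>\<^sub>F t in at s within I. C2_holder_norm \<alpha> (\<lambda>x. wave (A t) x - wave (A s) x)
          \<le> 5 * ?C t * derivative_weight_sum"
        using I by eventually_elim (simp only: diff wave_C2_holder_norm(2)[OF A_diff[OF s] assms(1,2)])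
      show "((\<lambda>t. 5 * ?C t * derivative_weight_sum) \<longlongrightarrow> 0) (at s within I)"
      proof -
        have "((\<lambda>t. 5 * ?C t * derivative_weight_sum) \<longlongrightarrow> 5 * ?C s * derivative_weight_sum) (at s within I)"
          by (intro tendsto_intros) auto
        then show ?thesis
          by simp
      qed
    qed auto
  qed
  moreover have "inj_on (\<lambda>s. (c s, wave (A s))) I"
  proof (rule inj_onI)
    fix s t assume s: "s \<in> I" and t: "t \<in> I" and "(c s, wave (A s)) = (c t, wave (A t))"
    then have "wave (A s) = wave (A t)"
      by (simp only: prod.inject)
    then have "complex_of_real (s / 2) = complex_of_real (t / 2)"
      unfolding coeff[OF s, symmetric] coeff[OF t, symmetric] by (rule arg_cong)
    then show "s = t"
      by simp
  qed
  moreover have "wave (A s) \<noteq> (\<lambda>_. 0)" if "s \<in> I" for s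
  proof
    assume "wave (A s) = (\<lambda>_. 0)"
    then have "complex_of_real (s / 2) = fourier_coeff (\<lambda>_. 0) (int m)"
      unfolding coeff[OF that, symmetric] by (rule arg_cong)
    then have "s = 0"
      by (simp add: fourier_coeff_def)
    then show False
      using that by (simp add: I_def)
  qed
  moreover have "solves_equation (\<lambda>z t. wave (A s) (z - c s * t))" if "s \<in> I" for s
    by (rule wave_solves_equation[OF A[OF that] even profile[OF that]])
  moreover have "is_interval I"
    by (auto simp: I_def is_interval_1)
  moreover have "\<exists>a\<in>I. \<exists>b\<in>I. a < b"
  proof (intro bexI)
    show "\<epsilon> / 2 < \<epsilon>" "\<epsilon> / 2 \<in> I" "\<epsilon> \<in> I"
      using \<open>\<epsilon> > 0\<close> by (auto simp: I_def)
  qed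
  ultimately show ?thesis
    by (intro exI[of _ I] exI[of _ c] exI[of _ "\<lambda>s. wave (A s)"]) blast
qed

end
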